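(* Let $q$ be an odd prime power, let $R=\mathbb{F}_q+u\mathbb{F}_q=\mathbb{F}_q[u]/(u^2)$, and let $\mathcal{C}$ be a linear code of length $n$ over $R$ with generator matrix $G$. Write $GG^T=A_0+uA_1$ with matrices $A_0,A_1$ over $\mathbb{F}_q$. Let $r=\operatorname{rank}_{\mathbb{F}_q}(A_0)$, and let $P$ be an invertible matrix over $\mathbb{F}_q$ such that $PA_0P^T=S\oplus\mathcal{O}$, where $S=I_r$ or $S=I_{r-1}\oplus[z]$ for some $z\in\mathbb{F}_q^\times\setminus(\mathbb{F}_q^\times)^2$. Write $$PA_1P^T=\begin{pmatrix} X & Y \\ Y^T & Z \end{pmatrix}$$ where $X$ is an $r\times r$ symmetric matrix over $\mathbb{F}_q$. Let $m=\mu(-Z)$. Then $$n_s(\mathcal{C})=\begin{cases} n+r+2m, & (-1)^{r+m}\det(S)\in(\mathbb{F}_q^\times)^2, \\ n+r+2m+1, & (-1)^{r+m}\det(S)\notin(\mathbb{F}_q^\times)^2. \end{cases}$$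
   Context: A linear code $\mathcal{C}$ of length $n$ over $R$ is an $R$-submodule of $R^n$. A generator matrix $G$ of $\mathcal{C}$ is a matrix whose rows $\mathbf{c}_1,\dots,\mathbf{c}_{k_1}\in R^n\setminus(uR)^n$ and $\mathbf{c}_{k_1+1},\dots,\mathbf{c}_{k_1+k_2}\in(uR)^n$ are codewords such that every codeword has a unique representation $\sum_{i=1}^{k_1}a_i\mathbf{c}_i+\sum_{j=k_1+1}^{k_1+k_2}b_j\mathbf{c}_j$ with $a_i\in R$, $b_j\in\mathbb{F}_q$. A code over $R$ is self-orthogonal if $\mathbf{x}\cdot\mathbf{y}=0$ (standard dot product) for all its codewords $\mathbf{x},\mathbf{y}$. A self-orthogonal embedding of $\mathcal{C}$ is a self-orthogonal code over $R$ generated by the rows of $[G\mid B]$ for some matrix $B$ over $R$ (possibly with zero columns). $n_s(\mathcal{C})$ denotes the smallest length of a self-orthogonal embedding of $\mathcal{C}$. For $m\ge0$ let $K_m=\begin{pmatrix} \mathcal{O} & I_m \\ I_m & \mathcal{O} \end{pmatrix}$ (a $2m\times2m$ matrix over $\mathbb{F}_q$). For a symmetric matrix $A$ over $\mathbb{F}_q$ ($q$ odd), $\mu(A)=\min\{m\ge0 : A=XK_mX^T\text{ for some matrix }X\text{ over }\mathbb{F}_q\}$ (with $\mu(\mathcal{O})=0$; this minimum always exists). $(\mathbb{F}_q^\times)^2$ is the set of nonzero squares. $\oplus$ denotes block-diagonal sum, $\mathcal{O}$ a zero matrix; the determinant of an empty matrix is $1$. *)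

theory Defs
  imports "Jordan_Normal_Form.DL_Rank"
begin

text \<open>The ring \<open>R = F + uF = F[u]/(u\<^sup>2)\<close>: the element \<open>Dual a b\<close> is \<open>a + ub\<close>.\<close>

datatype 'a dual = Dual (base_part: 'a) (u_part: 'a)

instantiation dual :: (comm_ring_1) comm_ring_1
begin

definition zero_dual :: "'a dual" where "0 = Dual 0 0"

definition one_dual :: "'a dual" where "1 = Dual 1 0"

definition plus_dual :: "'a dual \<Rightarrow> 'a dual \<Rightarrow> 'a dual" where
  "x + y = Dual (base_part x + base_part y) (u_part x + u_part y)"

definition uminus_dual :: "'a dual \<Rightarrow> 'a dual" where
  "- x = Dual (- base_part x) (- u_part x)"

definition minus_dual :: "'a dual \<Rightarrow> 'a dual \<Rightarrow> 'a dual" where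
  "x - y = Dual (base_part x - base_part y) (u_part x - u_part y)"

definition times_dual :: "'a dual \<Rightarrow> 'a dual \<Rightarrow> 'a dual" where
  "x * y = Dual (base_part x * base_part y) (base_part x * u_part y + u_part x * base_part y)"

instance
  by standard
    (simp_all add: zero_dual_def one_dual_def plus_dual_def uminus_dual_def minus_dual_def
      times_dual_def algebra_simps)

end

definition of_base :: "'a::zero \<Rightarrow> 'a dual" where
  "of_base a = Dual a 0"

definition dual_u :: "'a::{zero,one} dual" where
  "dual_u = Dual 0 1"

lemma dual_u_square: "dual_u * dual_u = (0 :: 'a::comm_ring_1 dual)"
  by (simp add: dual_u_def times_dual_def zero_dual_def)

lemma dual_decomp: "x = of_base (base_part x) + dual_u * of_base (u_part x)"
  for x :: "'a::comm_ring_1 dual"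
  by (cases x) (simp add: dual_u_def of_base_def times_dual_def plus_dual_def)

definition linear_code :: "nat \<Rightarrow> 'a::comm_ring_1 dual vec set \<Rightarrow> bool" where
  "linear_code n C \<longleftrightarrow>
     LinearCombinations.submodule class_ring C (module_vec TYPE('a dual) n)"

definition code_generated_by :: "nat \<Rightarrow> 'a::comm_ring_1 dual vec set \<Rightarrow> 'a dual vec set" where
  "code_generated_by n V = LinearCombinations.module.span class_ring (module_vec TYPE('a dual) n) V"

text \<open>The set \<open>(uR)\<^sup>n\<close>; note that \<open>x \<in> uR\<close> is \<open>dual_u dvd x\<close>.\<close>

definition uR_vec :: "nat \<Rightarrow> 'a::comm_ring_1 dual vec set" where
  "uR_vec n = {v \<in> carrier_vec n. \<forall>i<n. dual_u dvd v $ i}"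

text \<open>For \<open>a \<in> R\<^sup>k\<^sup>1\<close> and \<open>b \<in> F\<^sup>k\<^sup>2\<close>, the vector \<open>transpose_mat G *\<^sub>v (a @\<^sub>v map_vec of_base b)\<close> is the
  combination of the rows of \<open>G\<close> with coefficients \<open>a\<close> for the first \<open>k1\<close> rows and \<open>b\<close> for the
  others. The uniqueness is that of the pair of coefficient vectors.\<close>

definition generator_matrix :: "nat \<Rightarrow> 'a::comm_ring_1 dual vec set \<Rightarrow> 'a dual mat \<Rightarrow> bool" where
  "generator_matrix n C G \<longleftrightarrow>
     (\<exists>k1 k2. G \<in> carrier_mat (k1 + k2) n \<and>
        (\<forall>i<k1 + k2. row G i \<in> C) \<and>
        (\<forall>i<k1. row G i \<notin> uR_vec n) \<and>
        (\<forall>i. k1 \<le> i \<and> i < k1 + k2 \<longrightarrow> row G i \<in> uR_vec n) \<and>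
        (\<forall>c\<in>C. \<exists>!p. fst p \<in> carrier_vec k1 \<and> snd p \<in> carrier_vec k2 \<and>
           c = transpose_mat G *\<^sub>v (fst p @\<^sub>v map_vec of_base (snd p))))"

definition self_orthogonal :: "'a::comm_ring_1 dual vec set \<Rightarrow> bool" where
  "self_orthogonal C \<longleftrightarrow> (\<forall>x\<in>C. \<forall>y\<in>C. x \<bullet> y = 0)"

definition append_cols :: "'a::zero mat \<Rightarrow> 'a mat \<Rightarrow> 'a mat" where
  "append_cols A B = four_block_mat A B (0\<^sub>m 0 (dim_col A)) (0\<^sub>m 0 (dim_col B))"

text \<open>\<open>D\<close> is a self-orthogonal embedding, of length \<open>N\<close>, of the code \<open>C\<close> of length \<open>n\<close>. Any generator
  matrix of \<open>C\<close> may be used, so that the notion depends on \<open>C\<close> only.\<close>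

definition self_orthogonal_embedding ::
  "nat \<Rightarrow> 'a::comm_ring_1 dual vec set \<Rightarrow> nat \<Rightarrow> 'a dual vec set \<Rightarrow> bool" where
  "self_orthogonal_embedding n C N D \<longleftrightarrow>
     (\<exists>G B l. N = n + l \<and> generator_matrix n C G \<and> B \<in> carrier_mat (dim_row G) l \<and>
        D = code_generated_by N (set (rows (append_cols G B))) \<and> self_orthogonal D)"

definition n_s :: "nat \<Rightarrow> 'a::comm_ring_1 dual vec set \<Rightarrow> nat" where
  "n_s n C = (LEAST N. \<exists>D. self_orthogonal_embedding n C N D)"

definition K_mat :: "nat \<Rightarrow> 'a::{zero,one} mat" where
  "K_mat m = four_block_mat (0\<^sub>m m m) (1\<^sub>m m) (1\<^sub>m m) (0\<^sub>m m m)"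

definition mu :: "'a::comm_ring_1 mat \<Rightarrow> nat" where
  "mu A = (LEAST m. \<exists>X \<in> carrier_mat (dim_row A) (2 * m). A = X * K_mat m * transpose_mat X)"

definition nonzero_squares :: "'a::field set" where
  "nonzero_squares = {x\<^sup>2 | x. x \<noteq> 0}"

end

theory Submission
  imports Defs "HOL-Number_Theory.Residues"
begin

text \<open>Write the added columns as \<open>B\<^sub>0 + u B\<^sub>1\<close>. Self-orthogonality means
  \<open>B\<^sub>0 B\<^sub>0\<^sup>T = - A\<^sub>0\<close> and \<open>B\<^sub>0 B\<^sub>1\<^sup>T + B\<^sub>1 B\<^sub>0\<^sup>T = - A\<^sub>1\<close>, and one may replace \<open>A\<^sub>0, A\<^sub>1\<close> by
  \<open>P A\<^sub>0 P\<^sup>T, P A\<^sub>1 P\<^sup>T\<close>. The first \<open>r\<close> rows \<open>U\<close> of \<open>B\<^sub>0\<close> then span a copy of the form \<open>-S\<close>, and the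
  remaining rows \<open>V\<close> are totally isotropic and orthogonal to \<open>U\<close>. The blocks \<open>X\<close> and \<open>Y\<close> impose no
  condition, while \<open>- Z = V V\<^sub>1\<^sup>T + V\<^sub>1 V\<^sup>T\<close> forces the rank of \<open>V\<close> to be at least \<open>m = \<mu>(-Z)\<close>. So the
  number \<open>l\<close> of columns is admissible iff the standard form on \<open>F\<^sup>l\<close> contains an orthogonal sum of
  \<open>-S\<close> and \<open>m\<close> hyperbolic planes. This needs \<open>l \<ge> r + 2 m\<close>, and for \<open>l = r + 2 m\<close> the
  determinants agree up to squares; conversely, over a finite field of odd order a nondegenerate
  form is determined by its rank and its determinant up to squares.\<close>

section \<open>Diagonal forms over finite fields\<close>

text \<open>The characteristic divides the order of the field, so characteristic 2 would make that
  order even.\<close>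

lemma two_neq_zero_odd_card:
  assumes "odd (card (UNIV :: 'a::{field,finite} set))"
  shows "(2 :: 'a) \<noteq> 0"
proof
  assume "(2 :: 'a) = 0"
  then have "of_nat 2 = (0 :: 'a)" by simp
  then have "CHAR('a) dvd 2" by (simp only: of_nat_eq_0_iff_char_dvd)
  moreover have "CHAR('a) \<noteq> 1" by simp
  ultimately have "CHAR('a) = 2"
    using two_is_prime_nat prime_nat_iff by blast
  with CHAR_dvd_CARD[where ?'a='a] assms show False by simp
qed

text \<open>Squaring is at most two-to-one, and 0 has only one root. The strict inequality is what
  the pigeonhole argument for binary forms needs.\<close>

lemma card_less_double_squares:
  "card (UNIV :: 'a::{field,finite} set) < 2 * card (range (\<lambda>x :: 'a. x\<^sup>2))"
proof -
  let ?Q = "range (\<lambda>x :: 'a. x\<^sup>2)"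
  define g where "g y = (SOME x :: 'a. x\<^sup>2 = y)" for y
  have g: "(g (x\<^sup>2))\<^sup>2 = x\<^sup>2" for x
    unfolding g_def by (rule someI[of _ x]) simp
  \<comment> \<open>\<open>g\<close> and its negative are the two branches of the square root;
    leaving 0 out of the second branch makes the final bound strict.\<close>
  have "x \<in> g ` ?Q \<union> (\<lambda>y. - g y) ` (?Q - {0})" for x
  proof (cases "x = 0")
    case True
    have "g 0 = 0" using g[of 0] by simp
    then show ?thesis using True by (auto intro!: image_eqI[of _ _ 0])
  next
    case False
    have "x = g (x\<^sup>2) \<or> x = - g (x\<^sup>2)"
      using g[of x] by (metis power2_eq_iff)
    then show ?thesis using False by auto
  qed
  then have "UNIV = g ` ?Q \<union> (\<lambda>y. - g y) ` (?Q - {0})" by blast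
  then have "card (UNIV :: 'a set) \<le> card (g ` ?Q) + card ((\<lambda>y. - g y) ` (?Q - {0}))"
    by (metis card_Un_le)
  also have "\<dots> \<le> card ?Q + card (?Q - {0})"
    by (intro add_mono card_image_le) auto
  also have "\<dots> < 2 * card ?Q"
  proof -
    have "0 \<in> ?Q" by (auto intro!: image_eqI[of _ _ 0])
    then have "card (?Q - {0}) < card ?Q" by (intro psubset_card_mono) auto
    then show ?thesis by simp
  qed
  finally show ?thesis .
qed

text \<open>Pigeonhole: the squares and the values \<open>d - D * s\<close> at squares
  \<open>s\<close> each fill more than half of the field, so they share an element.\<close>

lemma binary_form_represents:
  fixes D d :: "'a::{field,finite}"
  assumes "D \<noteq> 0"
  shows "\<exists>x y. x\<^sup>2 + D * y\<^sup>2 = d"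
proof (rule ccontr)
  assume *: "\<not> ?thesis"
  let ?Q = "range (\<lambda>x :: 'a. x\<^sup>2)"
  let ?f = "\<lambda>s. d - D * s"
  have "?Q \<inter> ?f ` ?Q = {}"
  proof -
    have "x\<^sup>2 \<noteq> ?f (y\<^sup>2)" for x y
      using * by (metis diff_add_cancel)
    then show ?thesis by auto
  qed
  then have "card ?Q + card (?f ` ?Q) = card (?Q \<union> ?f ` ?Q)"
    by (simp add: card_Un_disjoint)
  also have "card (?f ` ?Q) = card ?Q"
    using assms by (intro card_image) (auto simp: inj_on_def)
  also have "card (?Q \<union> ?f ` ?Q) \<le> card (UNIV :: 'a set)"
    by (intro card_mono) auto
  finally show False using card_less_double_squares[where ?'a='a] by simp
qed

text \<open>Associativity with side conditions on dimensions instead of carriers, so that the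
  simplifier discharges them without guessing sizes.\<close>

lemma mult_assoc_dim:
  "dim_col A = dim_row B \<Longrightarrow> dim_col B = dim_row C \<Longrightarrow> A * B * C = A * (B * C :: 'a::comm_ring_1 mat)"
  by (rule assoc_mult_mat) auto

lemma transpose_mult_dim:
  "dim_col A = dim_row B \<Longrightarrow>
   transpose_mat (A * B) = transpose_mat B * transpose_mat (A :: 'a::comm_ring_1 mat)"
  by (rule transpose_mult) auto

lemma mat_diag_add:
  "mat_diag (a + b) f =
   four_block_mat (mat_diag a f) (0\<^sub>m a b) (0\<^sub>m b a) (mat_diag b (\<lambda>i. f (a + i)))"
  by (rule eq_matI) (auto simp: mat_diag_def)

lemma det_mat_diag: "det (mat_diag n f :: 'a::comm_ring_1 mat) = (\<Prod>i<n. f i)"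
proof -
  have "det (mat_diag n f) = prod_list (diag_mat (mat_diag n f))"
    by (rule det_upper_triangular[of _ n]) (auto simp: mat_diag_def upper_triangular_def)
  also have "diag_mat (mat_diag n f) = map f [0..<n]"
    by (auto simp: diag_mat_def mat_diag_def)
  finally show ?thesis
    by (simp add: prod.list_conv_set_nth lessThan_atLeast0)
qed

text \<open>Congruence respects orthogonal sums, so a change of basis can be made in one summand
  alone.\<close>

lemma gram_four_block_diag:
  fixes M N :: "'a::comm_ring_1 mat"
  assumes [simp]: "M \<in> carrier_mat a c" "D \<in> carrier_mat c c" "N \<in> carrier_mat b d" "E \<in> carrier_mat d d"
  shows "four_block_mat M (0\<^sub>m a d) (0\<^sub>m b c) N * four_block_mat D (0\<^sub>m c d) (0\<^sub>m d c) E
      * transpose_mat (four_block_mat M (0\<^sub>m a d) (0\<^sub>m b c) N)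
    = four_block_mat (M * D * transpose_mat M) (0\<^sub>m a b) (0\<^sub>m b a) (N * E * transpose_mat N)"
proof -
  have [simp]: "M * D \<in> carrier_mat a c" "N * E \<in> carrier_mat b d"
    using mult_carrier_mat[OF assms(1,2)] mult_carrier_mat[OF assms(3,4)] by auto
  have [simp]: "M * D * transpose_mat M \<in> carrier_mat a a" "N * E * transpose_mat N \<in> carrier_mat b b"
    using mult_carrier_mat[OF \<open>M * D \<in> _\<close>] mult_carrier_mat[OF \<open>N * E \<in> _\<close>] by auto
  have [simp]: "M * 0\<^sub>m c e = 0\<^sub>m a e" "0\<^sub>m e d * E = 0\<^sub>m e d" "0\<^sub>m e c * D = 0\<^sub>m e c" "N * 0\<^sub>m d e = 0\<^sub>m b e"
    "M * D * 0\<^sub>m c e = 0\<^sub>m a e" "N * E * 0\<^sub>m d e = 0\<^sub>m b e"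
    "0\<^sub>m e d * transpose_mat N = 0\<^sub>m e b" "0\<^sub>m e c * transpose_mat M = 0\<^sub>m e a" for e
    by (rule right_mult_zero_mat left_mult_zero_mat, simp)+
  show ?thesis
    by (subst transpose_four_block_mat[of _ a c _ d _ b], simp_all,
        subst mult_four_block_mat[of _ a c _ d _ b _ _ c _ d], simp_all,
        subst mult_four_block_mat[of _ a c _ d _ b _ _ a _ b], simp_all)
qed

text \<open>The last two diagonal entries \<open>a, b\<close> can be traded for \<open>ab, 1\<close>, because \<open>ab y\<^sup>2 + x\<^sup>2\<close> represents
  \<open>a\<close> and the orthogonal complement of a vector of norm \<open>a\<close> then has discriminant \<open>b\<close>.\<close>

lemma gram_mat_diag:
  fixes d :: "nat \<Rightarrow> 'a::{field,finite}"
  assumes "(\<Prod>i<l. d i) \<in> nonzero_squares"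
  shows "\<exists>E \<in> carrier_mat l l. E * transpose_mat E = mat_diag l d"
  using assms
proof (induction l arbitrary: d rule: less_induct)
  case (less l)
  consider "l = 0" | "l = 1" | n where "l = n + 2"
    by (metis One_nat_def add_2_eq_Suc' not0_implies_Suc)
  then show ?case
  proof cases
    case 1
    then show ?thesis by (intro bexI[of _ "0\<^sub>m 0 0"]) (auto simp: mat_diag_def)
  next
    case 2
    then obtain x where "d 0 = x\<^sup>2" using less.prems by (auto simp: nonzero_squares_def)
    then show ?thesis using 2
      by (intro bexI[of _ "mat_diag l (\<lambda>_. x)"])
        (auto simp: mat_diag_def scalar_prod_def power2_eq_square)
  next
    case 3
    let ?D = "d n * d (Suc n)"
    have nz: "(\<Prod>i<l. d i) \<noteq> 0" using less.prems by (force simp: nonzero_squares_def)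
    then have dn: "d n \<noteq> 0" "d (Suc n) \<noteq> 0" using 3 by auto
    \<comment> \<open>The last two entries are merged into their product: the length drops by one
      and the total product is kept. The split-off entry 1 is appended again in \<open>E2\<close>,
      whose Gram matrix has diagonal \<open>e\<close>.\<close>
    define d' where "d' = d(n := ?D)"
    have "(\<Prod>i<Suc n. d' i) = (\<Prod>i<l. d i)"
      using 3 by (simp add: lessThan_Suc d'_def mult.commute mult.left_commute cong: prod.cong_simp)
    then obtain E where E: "E \<in> carrier_mat (Suc n) (Suc n)" "E * transpose_mat E = mat_diag (Suc n) d'"
      using less.IH[of "Suc n" d'] less.prems 3 by auto
    define e where "e i = (if i = n then ?D else if i = Suc n then 1 else d i)" for i
    define E2 where "E2 = four_block_mat E (0\<^sub>m (Suc n) 1) (0\<^sub>m 1 (Suc n)) (1\<^sub>m 1)"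
    have E2: "E2 \<in> carrier_mat l l"
      unfolding E2_def using 3 four_block_carrier_mat[OF E(1), of "1\<^sub>m 1" 1 1] by simp
    have "E2 * transpose_mat E2 = E2 * 1\<^sub>m l * transpose_mat E2" using E2 by simp
    also have "\<dots> = four_block_mat (mat_diag (Suc n) d') (0\<^sub>m (Suc n) 1) (0\<^sub>m 1 (Suc n)) (1\<^sub>m 1)"
      using gram_four_block_diag[OF E(1) one_carrier_mat one_carrier_mat[of 1] one_carrier_mat] E 3
      by (simp add: E2_def)
    also have "\<dots> = mat_diag l e"
      using 3 by (auto simp: mat_diag_def e_def d'_def intro!: eq_matI)
    finally have gE2: "E2 * transpose_mat E2 = mat_diag l e" .
    obtain x y where xy: "x\<^sup>2 + ?D * y\<^sup>2 = d n"
      using binary_form_represents[of ?D] dn by (meson mult_eq_0_iff)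
    \<comment> \<open>For the form with diagonal \<open>?D\<close>, 1 the first row
      \<open>(y, x)\<close> has norm \<open>d n\<close>; the second row is orthogonal to it and has
      norm \<open>d (Suc n)\<close>, which is the identity \<open>B\<close> below.\<close>
    define Q2 where "Q2 = mat 2 2 (\<lambda>(i, j). if i = 0 then if j = 0 then y else x
      else if j = 0 then x / d n else - ?D * y / d n)"
    have Q2: "Q2 \<in> carrier_mat 2 2" by (simp add: Q2_def)
    have gQ2: "Q2 * mat_diag 2 (\<lambda>i. e (n + i)) * transpose_mat Q2 = mat_diag 2 (\<lambda>i. d (n + i))"
    proof -
      have "Q2 * mat_diag 2 (\<lambda>i. e (n + i)) = mat 2 2 (\<lambda>(i, j). Q2 $$ (i, j) * e (n + j))"
        by (rule mat_diag_mult_right[OF Q2])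
      have xy': "x * x + ?D * (y * y) = d n" using xy by (simp add: power2_eq_square)
      have "d (Suc n) * (x * x + ?D * (y * y)) = d (Suc n) * d n" by (simp only: xy')
      then have B: "x * (x * ?D) / (d n * d n) + ?D * (y * (?D * y)) / (d n * d n) = d (Suc n)"
        using dn by (simp add: field_simps)
      show ?thesis
        unfolding \<open>Q2 * _ = _\<close>
        using B xy' dn
        by (intro eq_matI)
          (auto simp: less_Suc_eq mat_diag_def Q2_def scalar_prod_def e_def
            numeral_2_eq_2 field_simps)
    qed
    define Q where "Q = four_block_mat (1\<^sub>m n) (0\<^sub>m n 2) (0\<^sub>m 2 n) Q2"
    have Q: "Q \<in> carrier_mat l l"
      unfolding Q_def using 3 four_block_carrier_mat[OF one_carrier_mat Q2] by simp
    have "Q * mat_diag l e * transpose_mat Q = mat_diag l d"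
    proof -
      have "mat_diag n e = mat_diag n d" by (auto simp: mat_diag_def e_def intro!: eq_matI)
      then show ?thesis
        unfolding \<open>l = n + 2\<close> mat_diag_add Q_def
        by (subst gram_four_block_diag[OF one_carrier_mat mat_diag_dim Q2 mat_diag_dim])
          (simp add: gQ2 transpose_one left_mult_one_mat[OF mat_diag_dim] right_mult_one_mat[OF mat_diag_dim])
    qed
    then have "Q * E2 * transpose_mat (Q * E2) = mat_diag l d"
      using Q E2 by (simp add: mult_assoc_dim transpose_mult_dim flip: gE2)
    then show ?thesis using Q E2 by (intro bexI[of _ "Q * E2"]) auto
  qed
qed

section \<open>Block matrices and rank factorization\<close>

lemma add_mult_distrib_dim:
  "dim_row A = dim_row B \<Longrightarrow> dim_col A = dim_col B \<Longrightarrow> dim_col B = dim_row C \<Longrightarrow>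
   (A + B) * C = A * C + B * (C :: 'a::comm_ring_1 mat)"
  by (rule add_mult_distrib_mat) auto

lemma mult_add_distrib_dim:
  "dim_col A = dim_row B \<Longrightarrow> dim_row B = dim_row C \<Longrightarrow> dim_col B = dim_col C \<Longrightarrow>
   A * (B + C) = A * B + A * (C :: 'a::comm_ring_1 mat)"
  by (rule mult_add_distrib_mat) auto

lemma minus_mult_distrib_dim:
  "dim_row A = dim_row B \<Longrightarrow> dim_col A = dim_col B \<Longrightarrow> dim_col B = dim_row C \<Longrightarrow>
   (A - B) * C = A * C - B * (C :: 'a::comm_ring_1 mat)"
  by (rule minus_mult_distrib_mat) auto

lemma mult_minus_distrib_dim:
  "dim_col A = dim_row B \<Longrightarrow> dim_row B = dim_row C \<Longrightarrow> dim_col B = dim_col C \<Longrightarrow>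
   A * (B - C) = A * B - A * (C :: 'a::comm_ring_1 mat)"
  by (rule mult_minus_distrib_mat) auto

lemma mat_minus_self: "A - A = 0\<^sub>m (dim_row A) (dim_col (A :: 'a::group_add mat))"
  by (rule eq_matI) auto

lemma mat_minus_zero:
  "dim_row A = a \<Longrightarrow> dim_col A = b \<Longrightarrow> A - 0\<^sub>m a b = (A :: 'a::group_add mat)"
  by (rule eq_matI) auto

lemmas mat_ring_dim = mat_minus_self mat_minus_zero mult_assoc_dim transpose_mult_dim add_mult_distrib_dim mult_add_distrib_dim
  minus_mult_distrib_dim mult_minus_distrib_dim

section \<open>Stacked and juxtaposed matrices and their products\<close>

lemma dim_append [simp]:
  "dim_row (A @\<^sub>r B) = dim_row A + dim_row B" "dim_col (A @\<^sub>r B) = dim_col A"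
  "dim_row (append_cols A B) = dim_row A" "dim_col (append_cols A B) = dim_col A + dim_col B"
  by (simp_all add: append_rows_def append_cols_def)

lemma append_cols_carrier [simp, intro]:
  "A \<in> carrier_mat nr nc1 \<Longrightarrow> B \<in> carrier_mat nr nc2 \<Longrightarrow> append_cols A B \<in> carrier_mat nr (nc1 + nc2)"
  by auto

lemma row_append_rows:
  "dim_col A = dim_col B \<Longrightarrow> i < dim_row A + dim_row B \<Longrightarrow>
   row (A @\<^sub>r B) i = (if i < dim_row A then row A i else row B (i - dim_row A))"
  by (rule eq_vecI) (auto simp: append_rows_def)

lemma col_append_cols:
  "dim_row A = dim_row B \<Longrightarrow> j < dim_col A + dim_col B \<Longrightarrow>
   col (append_cols A B) j = (if j < dim_col A then col A j else col B (j - dim_col A))"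
  by (rule eq_vecI) (auto simp: append_cols_def)

lemma row_append_cols:
  "dim_row A = dim_row B \<Longrightarrow> i < dim_row A \<Longrightarrow> row (append_cols A B) i = row A i @\<^sub>v row B i"
  by (rule eq_vecI) (auto simp: append_cols_def)

lemma transpose_append_rows:
  "dim_col A = dim_col B \<Longrightarrow>
   transpose_mat (A @\<^sub>r B) = append_cols (transpose_mat A) (transpose_mat B)"
  by (rule eq_matI) (auto simp: append_rows_def append_cols_def)

lemma transpose_append_cols:
  "dim_row A = dim_row B \<Longrightarrow>
   transpose_mat (append_cols A B) = transpose_mat A @\<^sub>r transpose_mat B"
  by (rule eq_matI) (auto simp: append_rows_def append_cols_def)

lemma append_rows_mult:
  "dim_col A = dim_col B \<Longrightarrow> dim_col B = dim_row C \<Longrightarrow> (A @\<^sub>r B) * C = A * C @\<^sub>r B * C"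
  by (rule eq_matI) (auto simp: row_append_rows append_rows_def[of "_ * _"])

lemma mult_append_cols:
  "dim_row A = dim_row B \<Longrightarrow> dim_col C = dim_row B \<Longrightarrow>
   C * append_cols A B = append_cols (C * A) (C * B)"
  by (rule eq_matI) (auto simp: col_append_cols append_cols_def[of "_ * _"])

lemma append_rows_mult_append_cols:
  "dim_col A = dim_row C \<Longrightarrow> dim_col B = dim_row C \<Longrightarrow> dim_row C = dim_row D \<Longrightarrow>
   (A @\<^sub>r B) * append_cols C D = four_block_mat (A * C) (A * D) (B * C) (B * D)"
  by (rule eq_matI) (auto simp: row_append_rows col_append_cols)

lemma append_cols_mult_append_rows:
  fixes A :: "'a::comm_ring_1 mat"
  assumes "dim_row A = dim_row B" "dim_col C = dim_col D" "dim_col A = dim_row C" "dim_col B = dim_row D"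
  shows "append_cols A B * (C @\<^sub>r D) = A * C + B * D"
proof -
  have "col (C @\<^sub>r D) j = col C j @\<^sub>v col D j" if "j < dim_col C" for j
    using that assms by (intro eq_vecI) (auto simp: append_rows_def)
  moreover have "(row A i @\<^sub>v row B i) \<bullet> (col C j @\<^sub>v col D j) = row A i \<bullet> col C j + row B i \<bullet> col D j"
    for i j
    using assms by (intro scalar_prod_append[of _ "dim_col A" _ "dim_col B"]) (auto intro: carrier_vecI)
  ultimately show ?thesis
    using assms by (intro eq_matI) (auto simp: row_append_cols)
qed

lemma append_rows_split:
  assumes "M \<in> carrier_mat (a + b) c"
  obtains A B where "A \<in> carrier_mat a c" "B \<in> carrier_mat b c" "M = A @\<^sub>r B"
proof
  show "mat a c (\<lambda>(i, j). M $$ (i, j)) \<in> carrier_mat a c" by simp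
  show "mat b c (\<lambda>(i, j). M $$ (a + i, j)) \<in> carrier_mat b c" by simp
  show "M = mat a c (\<lambda>(i, j). M $$ (i, j)) @\<^sub>r mat b c (\<lambda>(i, j). M $$ (a + i, j))"
    using assms by (intro eq_matI) (auto simp: append_rows_def)
qed

lemma four_block_mat_eq_iff:
  assumes "A \<in> carrier_mat a c" "D \<in> carrier_mat b d" "A' \<in> carrier_mat a c" "D' \<in> carrier_mat b d"
    "B \<in> carrier_mat a d" "C \<in> carrier_mat b c" "B' \<in> carrier_mat a d" "C' \<in> carrier_mat b c"
  shows "four_block_mat A B C D = four_block_mat A' B' C' D' \<longleftrightarrow> A = A' \<and> B = B' \<and> C = C' \<and> D = D'"
proof
  assume e: "four_block_mat A B C D = four_block_mat A' B' C' D'"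
  have *: "four_block_mat A B C D $$ (i, j) = four_block_mat A' B' C' D' $$ (i, j)" for i j
    by (simp add: e)
  have "A = A'"
  proof (rule eq_matI)
    fix i j assume "i < dim_row A'" "j < dim_col A'"
    then show "A $$ (i, j) = A' $$ (i, j)" using *[of i j] assms by auto
  qed (use assms in auto)
  moreover have "B = B'"
  proof (rule eq_matI)
    fix i j assume "i < dim_row B'" "j < dim_col B'"
    then show "B $$ (i, j) = B' $$ (i, j)" using *[of i "c + j"] assms by auto
  qed (use assms in auto)
  moreover have "C = C'"
  proof (rule eq_matI)
    fix i j assume "i < dim_row C'" "j < dim_col C'"
    then show "C $$ (i, j) = C' $$ (i, j)" using *[of "a + i" j] assms by auto
  qed (use assms in auto)
  moreover have "D = D'"
  proof (rule eq_matI)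
    fix i j assume "i < dim_row D'" "j < dim_col D'"
    then show "D $$ (i, j) = D' $$ (i, j)" using *[of "a + i" "c + j"] assms by auto
  qed (use assms in auto)
  ultimately show "A = A' \<and> B = B' \<and> C = C' \<and> D = D'" by blast
qed auto

text \<open>If \<open>p > l\<close>, zero columns added to \<open>A\<close> and zero rows added to
  \<open>B\<close> make both square without changing the product; but a square matrix with a zero
  column has determinant 0.\<close>

lemma det_mult_nonzero_imp_le:
  fixes A :: "'a::field mat"
  assumes A: "A \<in> carrier_mat p l" and B: "B \<in> carrier_mat l p" and "det (A * B) \<noteq> 0"
  shows "p \<le> l"
proof (rule ccontr)
  assume "\<not> p \<le> l"
  then obtain e where p: "p = l + e" "e > 0" by (metis less_imp_add_positive not_le)
  define A' where "A' = append_cols A (0\<^sub>m p e)"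
  define B' where "B' = B @\<^sub>r 0\<^sub>m e p"
  have A': "A' \<in> carrier_mat p p" using A p by (auto simp: A'_def)
  have B': "B' \<in> carrier_mat p p" using B p by (auto simp: B'_def)
  have "A' * B' = A * B"
    using A B unfolding A'_def B'_def
    by (subst append_cols_mult_append_rows) auto
  moreover have "A' *\<^sub>v unit_vec p l = 0\<^sub>v p"
    using A' A p by (intro eq_vecI) (auto simp: A'_def append_cols_def)
  then have "det A' = 0"
    using det_0_iff_vec_prod_zero_field[OF A'] p by (metis less_add_same_cancel1 unit_vec_carrier unit_vec_nonzero)
  ultimately show False using assms(3) det_mult[OF A' B'] by simp
qed

text \<open>For \<open>s\<close> maximal with \<open>L V R = 1\<close>, a nonzero entry of \<open>V - V R L V\<close> would allow bordering \<open>L\<close> and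
  \<open>R\<close> by one more row and column.\<close>

lemma rank_factorization:
  fixes V :: "'a::field mat"
  assumes V: "V \<in> carrier_mat p l"
  obtains s L R where "L \<in> carrier_mat s p" "R \<in> carrier_mat l s"
    "L * V * R = 1\<^sub>m s" "V * R * (L * V) = V"
proof -
  define P where "P s \<longleftrightarrow> (\<exists>L \<in> carrier_mat s p. \<exists>R \<in> carrier_mat l s. L * V * R = 1\<^sub>m s)" for s
  have bound: "s \<le> l" if Ps: "P s" for s
  proof -
    obtain L R where "L \<in> carrier_mat s p" "R \<in> carrier_mat l s" "L * V * R = 1\<^sub>m s"
      using Ps by (auto simp: P_def)
    then show ?thesis using V by (intro det_mult_nonzero_imp_le[of "L * V" s l R]) auto
  qed
  have "P 0" unfolding P_def
    by (intro bexI[of _ "0\<^sub>m 0 p"] bexI[of _ "0\<^sub>m l 0"]) (use V in auto)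
  then obtain s where s: "P s" "\<And>t. P t \<Longrightarrow> t \<le> s"
    using bound by (metis GreatestI_nat Greatest_le_nat)
  then obtain L R where L: "L \<in> carrier_mat s p" and R: "R \<in> carrier_mat l s" and LVR: "L * V * R = 1\<^sub>m s"
    by (auto simp: P_def)
  note [simp] = L[THEN carrier_matD(1)] L[THEN carrier_matD(2)] R[THEN carrier_matD(1)]
    R[THEN carrier_matD(2)] V[THEN carrier_matD(1)] V[THEN carrier_matD(2)]
  have LVR': "L * (V * R) = 1\<^sub>m s" using LVR by (simp add: mult_assoc_dim)
  have LVRX: "L * (V * (R * X)) = X" if "dim_row X = s" for X
  proof -
    have "L * (V * (R * X)) = L * (V * R) * X" using that by (simp add: mult_assoc_dim)
    then show ?thesis using that by (simp add: LVR')
  qed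
  have "V * R * (L * V) = V"
  proof (rule ccontr)
    assume neq: "V * R * (L * V) \<noteq> V"
    define F where "F = V - V * R * (L * V)"
    obtain i j where ij: "i < p" "j < l" "F $$ (i, j) \<noteq> 0"
    proof -
      have "\<not> (\<forall>i<p. \<forall>j<l. F $$ (i, j) = 0)"
      proof
        assume "\<forall>i<p. \<forall>j<l. F $$ (i, j) = 0"
        then have "V * R * (L * V) = V" by (intro eq_matI) (auto simp: F_def)
        then show False using neq by simp
      qed
      then show ?thesis using that by blast
    qed
    \<comment> \<open>\<open>u\<close> and \<open>v\<close> single out the nonzero entry of
      \<open>F\<close> and normalise it to 1.\<close>
    define u where "u = mat 1 p (\<lambda>(_, k). if k = i then inverse (F $$ (i, j)) else 0)"
    define v where "v = mat l 1 (\<lambda>(k, _). if k = j then 1 else (0 :: 'a))"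
    have [simp]: "dim_row u = 1" "dim_col u = p" "dim_row v = l" "dim_col v = 1"
      by (simp_all add: u_def v_def)
    have uFv: "u * (F * v) = 1\<^sub>m 1"
    proof -
      have "(F * v) $$ (k, 0) = F $$ (k, j)" if "k < p" for k
        using that ij by (simp add: F_def v_def scalar_prod_def sum.delta if_distrib cong: if_cong)
      then show ?thesis
        using ij by (intro eq_matI)
          (auto simp: u_def scalar_prod_def F_def if_distrib if_distribR sum.delta cong: if_cong)
    qed
    \<comment> \<open>As \<open>L * V * R\<close> is the identity, \<open>V * R * L\<close> and
      \<open>R * (L * V)\<close> are idempotent. Their complements modify \<open>u\<close> and
      \<open>v\<close> so that the off-diagonal blocks of the bordered product vanish, while
      \<open>a * (V * b)\<close> is still \<open>u * (F * v)\<close>.\<close>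
    define a where "a = u * (1\<^sub>m p - V * R * L)"
    define b where "b = (1\<^sub>m l - R * (L * V)) * v"
    have [simp]: "dim_row a = 1" "dim_col a = p" "dim_row b = l" "dim_col b = 1"
      by (simp_all add: a_def b_def)
    have aVR: "a * (V * R) = 0\<^sub>m 1 s"
      by (simp add: a_def mat_ring_dim LVR')
    have LVb: "L * (V * b) = 0\<^sub>m s 1"
      by (simp add: b_def mat_ring_dim LVRX)
    have aVb: "a * (V * b) = 1\<^sub>m 1"
    proof -
      have "a * (V * b) = u * (F * v)"
        by (simp add: a_def b_def F_def mat_ring_dim LVRX)
      then show ?thesis by (simp add: uFv)
    qed
    have "(L @\<^sub>r a) * V * append_cols R b = (L @\<^sub>r a) * append_cols (V * R) (V * b)"
      by (simp add: mult_assoc_dim mult_append_cols)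
    also have "\<dots> = 1\<^sub>m (s + 1)"
      by (subst append_rows_mult_append_cols) (simp_all add: LVR' aVR LVb aVb)
    finally have "P (s + 1)" unfolding P_def
      by (intro bexI[of _ "L @\<^sub>r a"] bexI[of _ "append_cols R b"]) auto
    then show False using s(2)[of "s + 1"] by simp
  qed
  then show thesis using that L R LVR by blast
qed

section \<open>Isotropic and hyperbolic spaces\<close>

text \<open>Turns a known product into a rewrite rule inside right-nested chains, where
  associativity has hidden the factor \<open>A * B\<close>.\<close>

lemma mult_left_cancel_dim:
  "A * B = C \<Longrightarrow> dim_col A = dim_row B \<Longrightarrow> dim_col B = dim_row X \<Longrightarrow>
   A * (B * X) = C * (X :: 'a::comm_ring_1 mat)"
  by (metis mult_assoc_dim)

lemma transpose_add_dim:
  "dim_row A = dim_row B \<Longrightarrow> dim_col A = dim_col B \<Longrightarrow>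
   transpose_mat (A + B) = transpose_mat A + transpose_mat B"
  by (rule transpose_add) auto

lemma transpose_smult_mat: "transpose_mat (c \<cdot>\<^sub>m A) = c \<cdot>\<^sub>m transpose_mat A"
  by (rule eq_matI) auto

lemma mat_add_uminus_self: "A + - A = 0\<^sub>m (dim_row A) (dim_col (A :: 'a::group_add mat))"
  by (rule eq_matI) auto

lemma add_zero_mat_dim:
  fixes A :: "'a::comm_ring_1 mat"
  shows "dim_row A = a \<Longrightarrow> dim_col A = b \<Longrightarrow> A + 0\<^sub>m a b = A"
    "dim_row A = a \<Longrightarrow> dim_col A = b \<Longrightarrow> 0\<^sub>m a b + A = A"
  by (auto intro!: eq_matI)

lemma det_uminus:
  fixes A :: "'a::comm_ring_1 mat"
  assumes "A \<in> carrier_mat n n"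
  shows "det (- A) = (-1) ^ n * det A"
proof -
  have "- A = (-1) \<cdot>\<^sub>m A" by (rule eq_matI) auto
  then show ?thesis using assms by simp
qed

lemma K_mat_dim [simp]: "dim_row (K_mat m) = 2 * m" "dim_col (K_mat m) = 2 * m"
  by (simp_all add: K_mat_def)

lemma append_cols_mult_K_mat:
  fixes M N :: "'a::comm_ring_1 mat"
  assumes "M \<in> carrier_mat p m" "N \<in> carrier_mat p m"
  shows "append_cols M N * K_mat m = append_cols N M"
proof -
  have "K_mat m = append_cols (0\<^sub>m m m) (1\<^sub>m m) @\<^sub>r append_cols (1\<^sub>m m) (0\<^sub>m m m :: 'a mat)"
    unfolding K_mat_def append_rows_def append_cols_def by (rule eq_matI) auto
  then have "append_cols M N * K_mat m
      = append_cols (0\<^sub>m p m) M + append_cols N (0\<^sub>m p m)"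
    using assms by (simp add: append_cols_mult_append_rows mult_append_cols)
  also have "\<dots> = append_cols N M"
    using assms unfolding append_cols_def by (intro eq_matI) auto
  finally show ?thesis .
qed

text \<open>The hyperbolic form pairs opposite halves of its arguments. Equal arguments give
  \<open>N M^T + M N^T\<close>, so \<open>mu\<close> measures how few columns such a symmetrised
  product needs.\<close>

lemma K_mat_form:
  fixes M N M' N' :: "'a::comm_ring_1 mat"
  assumes "M \<in> carrier_mat p m" "N \<in> carrier_mat p m" "M' \<in> carrier_mat q m" "N' \<in> carrier_mat q m"
  shows "append_cols M N * K_mat m * transpose_mat (append_cols M' N')
    = N * transpose_mat M' + M * transpose_mat N'"
proof -
  have "append_cols M N * K_mat m * transpose_mat (append_cols M' N')
      = append_cols N M * (transpose_mat M' @\<^sub>r transpose_mat N')"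
    using assms by (subst append_cols_mult_K_mat[OF assms(1,2)], subst transpose_append_cols) auto
  also have "\<dots> = N * transpose_mat M' + M * transpose_mat N'"
    using assms by (subst append_cols_mult_append_rows) auto
  finally show ?thesis .
qed

lemma mu_le:
  assumes "Q \<in> carrier_mat (dim_row A) (2 * m)" "A = Q * K_mat m * transpose_mat Q"
  shows "mu A \<le> m"
  unfolding mu_def using assms by (intro Least_le bexI[of _ Q])

text \<open>With \<open>H\<close> half of \<open>A\<close>, a symmetric \<open>A\<close> is
  \<open>H + H^T\<close>, which \<open>[1 | H]\<close> realises with \<open>p\<close> planes. Hence
  the set in the definition of \<open>mu\<close> is nonempty and its least element is
  attained.\<close>

lemma mu_attained:
  fixes A :: "'a::field mat"
  assumes two: "(2 :: 'a) \<noteq> 0" and A: "A \<in> carrier_mat p p" and sym: "transpose_mat A = A"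
  obtains Q where "Q \<in> carrier_mat p (2 * mu A)" "A = Q * K_mat (mu A) * transpose_mat Q"
proof -
  let ?P = "\<lambda>m. \<exists>Q \<in> carrier_mat (dim_row A) (2 * m). A = Q * K_mat m * transpose_mat Q"
  define H where "H = (1 / 2) \<cdot>\<^sub>m A"
  have H: "H \<in> carrier_mat p p" "transpose_mat H = H"
    using A sym by (auto simp: H_def transpose_smult_mat)
  have HH: "H + H = A"
    using A two by (intro eq_matI) (auto simp: H_def field_simps)
  have "append_cols (1\<^sub>m p) H * K_mat p * transpose_mat (append_cols (1\<^sub>m p) H) = A"
    using H by (subst K_mat_form[of _ p p _ _ p]) (auto simp: HH)
  moreover have "append_cols (1\<^sub>m p) H \<in> carrier_mat (dim_row A) (2 * p)"
    using H A by auto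
  ultimately have "?P p" by metis
  then have "?P (mu A)" unfolding mu_def by (rule LeastI)
  then obtain Q where "Q \<in> carrier_mat (dim_row A) (2 * mu A)" "A = Q * K_mat (mu A) * transpose_mat Q"
    by (elim bexE)
  then show thesis using that A by (metis carrier_matD(1))
qed

text \<open>The rows of \<open>V\<close> span a totally isotropic space inside the orthogonal complement of the rows
  of \<open>U\<close>. A basis \<open>W\<close> of it has at least \<open>mu (- Z)\<close> elements, and a dual family of \<open>W\<close> shows that
  \<open>W\<close> sits in a hyperbolic space of twice the dimension, orthogonal to \<open>U\<close>.\<close>

lemma isotropic_lower_bound:
  fixes S U V V1 Z :: "'a::field mat"
  assumes carr: "S \<in> carrier_mat r r" "T \<in> carrier_mat r r" "U \<in> carrier_mat r l"
      "V \<in> carrier_mat p l" "V1 \<in> carrier_mat p l" "Z \<in> carrier_mat p p"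
    and S: "T * S = 1\<^sub>m r" "det S \<noteq> 0"
    and UU: "U * transpose_mat U = - S"
    and UV: "U * transpose_mat V = 0\<^sub>m r p"
    and VV: "V * transpose_mat V = 0\<^sub>m p p"
    and VV1: "V * transpose_mat V1 + V1 * transpose_mat V = - Z"
  shows "r + 2 * mu (- Z) \<le> l"
    and "l = r + 2 * mu (- Z) \<Longrightarrow> (-1) ^ (r + mu (- Z)) * det S \<in> nonzero_squares"
proof -
  obtain s L R where L: "L \<in> carrier_mat s p" and R: "R \<in> carrier_mat l s"
    and LVR: "L * V * R = 1\<^sub>m s" and VRLV: "V * R * (L * V) = V"
    using rank_factorization[OF \<open>V \<in> _\<close>] .
  note [simp] = carr[THEN carrier_matD(1)] carr[THEN carrier_matD(2)] L[THEN carrier_matD(1)]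
    L[THEN carrier_matD(2)] R[THEN carrier_matD(1)] R[THEN carrier_matD(2)]
  \<comment> \<open>The factorization of \<open>V\<close> as \<open>?M * (L * V)\<close> passes
    through \<open>s\<close> rows, so \<open>- Z\<close> is a symmetrised product of
    \<open>?M\<close> and \<open>?N\<close>, each with \<open>s\<close> columns.\<close>
  have mu: "mu (- Z) \<le> s"
  proof (rule mu_le)
    let ?M = "V * R" and ?N = "V1 * transpose_mat (L * V)"
    have t: "transpose_mat V = transpose_mat (L * V) * transpose_mat (V * R)"
      by (subst VRLV[symmetric], subst transpose_mult_dim) simp_all
    have "- Z = V * transpose_mat V1 + V1 * transpose_mat V" by (simp only: VV1)
    also have "V1 * transpose_mat V = ?N * transpose_mat ?M"
      by (subst t) (simp add: mult_assoc_dim)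
    also have "V * transpose_mat V1 = ?M * transpose_mat ?N"
      by (subst VRLV[symmetric]) (simp add: mult_assoc_dim transpose_mult_dim)
    also have "?M * transpose_mat ?N + ?N * transpose_mat ?M = ?N * transpose_mat ?M + ?M * transpose_mat ?N"
      by (rule comm_add_mat[of _ p p]) auto
    also have "\<dots> = append_cols ?M ?N * K_mat s * transpose_mat (append_cols ?M ?N)"
      by (rule K_mat_form[of _ p s _ _ p, symmetric]) auto
    finally show "- Z = append_cols ?M ?N * K_mat s * transpose_mat (append_cols ?M ?N)" .
  qed auto
  define W where "W = L * V"
  \<comment> \<open>Since \<open>W * R\<close> is the identity, \<open>transpose_mat R\<close> is
    dual to \<open>W\<close>. The added term makes it orthogonal to \<open>U\<close>, with a plus
    sign because \<open>U\<close> has Gram matrix \<open>- S\<close>; the pairing with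
    \<open>W\<close> is kept, as \<open>W\<close> is orthogonal to \<open>U\<close>.\<close>
  define W' where "W' = transpose_mat R + transpose_mat R * transpose_mat U * T * U"
  have [simp]: "dim_row W = s" "dim_col W = l" "dim_row W' = s" "dim_col W' = l"
    by (simp_all add: W_def W'_def)
  have VU: "V * transpose_mat U = 0\<^sub>m p r"
    using arg_cong[OF UV, of transpose_mat] by (simp add: transpose_mult_dim zero_transpose_mat)
  have UW: "U * transpose_mat W = 0\<^sub>m r s"
    by (simp add: W_def transpose_mult_dim mult_left_cancel_dim[OF UV])
  have WU: "W * transpose_mat U = 0\<^sub>m s r"
    by (simp add: W_def mult_assoc_dim VU)
  have WW: "W * transpose_mat W = 0\<^sub>m s s"
    by (simp add: W_def transpose_mult_dim mult_assoc_dim mult_left_cancel_dim[OF VV])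
  have W'U: "W' * transpose_mat U = 0\<^sub>m s r"
    by (simp add: W'_def add_mult_distrib_dim mult_assoc_dim UU S mat_add_uminus_self)
  have UW': "U * transpose_mat W' = 0\<^sub>m r s"
    using arg_cong[OF W'U, of transpose_mat] by (simp add: transpose_mult_dim zero_transpose_mat)
  have WW': "W * transpose_mat W' = 1\<^sub>m s"
    by (simp add: W'_def transpose_add_dim transpose_mult_dim mult_add_distrib_dim
        mult_left_cancel_dim[OF WU] add_zero_mat_dim) (simp add: W_def LVR)
  have W'W: "W' * transpose_mat W = 1\<^sub>m s"
    using arg_cong[OF WW', of transpose_mat] by (simp add: transpose_mult_dim)
  define H where "H = W @\<^sub>r W'"
  define E where "E = U @\<^sub>r H"
  have [simp]: "dim_row H = s + s" "dim_col H = l" by (simp_all add: H_def)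
  have E: "E \<in> carrier_mat (r + (s + s)) l" by (auto simp: E_def)
  define N where "N = W' * transpose_mat W'"
  have HH: "H * transpose_mat H = four_block_mat (0\<^sub>m s s) (1\<^sub>m s) (1\<^sub>m s) N"
    by (simp add: H_def transpose_append_rows append_rows_mult_append_cols WW WW' W'W N_def)
  have UH: "U * transpose_mat H = 0\<^sub>m r (s + s)"
    by (simp add: H_def transpose_append_rows mult_append_cols UW UW')
      (auto simp: append_cols_def intro!: eq_matI)
  have HU: "H * transpose_mat U = 0\<^sub>m (s + s) r"
    using arg_cong[OF UH, of transpose_mat] by (simp add: transpose_mult_dim zero_transpose_mat)
  have EE: "E * transpose_mat E = four_block_mat (- S) (0\<^sub>m r (s + s)) (0\<^sub>m (s + s) r) (H * transpose_mat H)"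
    by (simp add: E_def transpose_append_rows append_rows_mult_append_cols UU UH HU)
  have N: "N \<in> carrier_mat s s" by (auto simp: N_def)
  \<comment> \<open>The Gram matrix \<open>N\<close> of the dual family is unknown, but it drops out
    against the zero block.\<close>
  have "det (H * transpose_mat H) = det (0\<^sub>m s s * N - 1\<^sub>m s * 1\<^sub>m s)"
    unfolding HH by (rule det_four_block_mat) (use N in auto)
  also have "0\<^sub>m s s * N - 1\<^sub>m s * 1\<^sub>m s = - 1\<^sub>m s" using N by (intro eq_matI) auto
  finally have "det (H * transpose_mat H) = (-1) ^ s"
    by (simp add: det_uminus[of _ s])
  then have dE: "det (E * transpose_mat E) = (-1) ^ (r + s) * det S"
    unfolding EE using carr(1)
    by (subst det_four_block_mat_lower_left_zero[of _ r _ "s + s"])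
      (auto simp: det_uminus[of _ r] power_add)
  then have le: "r + (s + s) \<le> l"
    using S(2) E by (intro det_mult_nonzero_imp_le[of E _ _ "transpose_mat E"]) auto
  then show "r + 2 * mu (- Z) \<le> l" using mu by simp
  \<comment> \<open>Equality of lengths forces \<open>s = mu (- Z)\<close> and makes
    \<open>E\<close> square, so its Gram determinant is the square of \<open>det E\<close>.\<close>
  assume l: "l = r + 2 * mu (- Z)"
  then have s: "s = mu (- Z)" using mu le by simp
  have E': "E \<in> carrier_mat l l" using E l s by (simp add: mult_2)
  then have "det (E * transpose_mat E) = (det E)\<^sup>2"
    using det_mult[OF E', of "transpose_mat E"] det_transpose[OF E'] by (simp add: power2_eq_square)
  then have *: "(-1) ^ (r + s) * det S = (det E)\<^sup>2" using dE by simp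
  moreover have "det E \<noteq> 0" using * S(2) by auto
  ultimately show "(-1) ^ (r + mu (- Z)) * det S \<in> nonzero_squares"
    unfolding s[symmetric] nonzero_squares_def by blast
qed

text \<open>The first \<open>r\<close> rows \<open>U\<close> of \<open>E\<close> realise \<open>-S\<close>, the others, \<open>W\<close>, a hyperbolic space orthogonal to them.
  With \<open>Q = [M | N]\<close> the rows \<open>[M | 0] W\<close> are isotropic and pair with \<open>[0 | N] W\<close> to \<open>M N\<^sup>T\<close>; the blocks
  \<open>X\<close> and \<open>Y\<close> are absorbed by multiples of \<open>U\<close>.\<close>

lemma exists_gram_pair:
  fixes S T E Q X Y :: "'a::field mat"
  assumes two: "(2 :: 'a) \<noteq> 0"
    and carr: "S \<in> carrier_mat r r" "T \<in> carrier_mat r r" "E \<in> carrier_mat (r + 2 * m) l"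
      "Q \<in> carrier_mat p (2 * m)" "X \<in> carrier_mat r r" "Y \<in> carrier_mat r p"
    and S: "S * T = 1\<^sub>m r" "transpose_mat T = T" "transpose_mat S = S"
    and E: "E * transpose_mat E = four_block_mat (- S) (0\<^sub>m r (2 * m)) (0\<^sub>m (2 * m) r) (K_mat m)"
    and Z: "- Z = Q * K_mat m * transpose_mat Q" and X: "transpose_mat X = X"
  shows "\<exists>B0 \<in> carrier_mat (r + p) l. \<exists>B1 \<in> carrier_mat (r + p) l.
    B0 * transpose_mat B0 = - four_block_mat S (0\<^sub>m r p) (0\<^sub>m p r) (0\<^sub>m p p) \<and>
    B0 * transpose_mat B1 + B1 * transpose_mat B0 = - four_block_mat X Y (transpose_mat Y) Z"
proof -
  obtain U W where UW_carr: "U \<in> carrier_mat r l" "W \<in> carrier_mat (2 * m) l" and EUW: "E = U @\<^sub>r W"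
    using append_rows_split[OF carr(3)] .
  have "transpose_mat Q \<in> carrier_mat (m + m) p" using carr(4) by (simp add: mult_2)
  from append_rows_split[OF this] obtain M' N' where "M' \<in> carrier_mat m p" "N' \<in> carrier_mat m p"
    "transpose_mat Q = M' @\<^sub>r N'" .
  then obtain M N where MN: "M \<in> carrier_mat p m" "N \<in> carrier_mat p m" and Q: "Q = append_cols M N"
    by (metis carrier_matD(2) transpose_append_rows transpose_carrier_mat transpose_transpose)
  define P where "P = append_cols M (0\<^sub>m p m)"
  define P' where "P' = append_cols (0\<^sub>m p m) N"
  define H where "H = (1 / 2) \<cdot>\<^sub>m X"
  have H: "H \<in> carrier_mat r r" "transpose_mat H = H"
    using carr X by (auto simp: H_def transpose_smult_mat)
  have HH: "H + H = X"
    using carr two by (intro eq_matI) (auto simp: H_def field_simps)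
  have PP': "P \<in> carrier_mat p (2 * m)" "P' \<in> carrier_mat p (2 * m)" using MN by (auto simp: P_def P'_def)
  note carrs = carr UW_carr MN H(1) PP'
  note [simp] = carrs[THEN carrier_matD(1)] carrs[THEN carrier_matD(2)] S(2,3) H(2)
  have PKP: "P * K_mat m * transpose_mat P = 0\<^sub>m p p"
    unfolding P_def using MN by (subst K_mat_form[of _ p m _ _ p]) (auto simp: zero_transpose_mat)
  have PKP': "P * K_mat m * transpose_mat P' = M * transpose_mat N"
    unfolding P_def P'_def using MN
    by (subst K_mat_form[of _ p m _ _ p]) (auto simp: zero_transpose_mat add_zero_mat_dim)
  have Z': "- Z = N * transpose_mat M + M * transpose_mat N"
    unfolding Z Q using MN by (subst K_mat_form[of _ p m _ _ p]) auto
  have "four_block_mat (U * transpose_mat U) (U * transpose_mat W) (W * transpose_mat U) (W * transpose_mat W)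
     = four_block_mat (- S) (0\<^sub>m r (2 * m)) (0\<^sub>m (2 * m) r) (K_mat m)"
    unfolding E[symmetric] EUW by (simp add: transpose_append_rows append_rows_mult_append_cols)
  then have UU: "U * transpose_mat U = - S" and UW: "U * transpose_mat W = 0\<^sub>m r (2 * m)"
    and WU: "W * transpose_mat U = 0\<^sub>m (2 * m) r" and WW: "W * transpose_mat W = K_mat m"
    by (subst (asm) four_block_mat_eq_iff[of _ r r _ "2 * m" "2 * m"]; auto)+
  define B0 where "B0 = U @\<^sub>r P * W"
  \<comment> \<open>As \<open>U\<close> has Gram matrix \<open>- S\<close> and \<open>T\<close>
    inverts \<open>S\<close>, pairing \<open>U\<close> with \<open>H * T * U\<close> gives
    \<open>- H\<close>, and with the \<open>Y\<close> term gives \<open>- Y\<close>. The product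
    occurs in both orders, so half of \<open>X\<close> is the right coefficient;
    \<open>P' * W\<close> produces the \<open>Z\<close> block.\<close>
  define B1 where "B1 = H * T * U @\<^sub>r (P' * W + transpose_mat Y * T * U)"
  have B: "B0 \<in> carrier_mat (r + p) l" "B1 \<in> carrier_mat (r + p) l"
    by (auto simp: B0_def B1_def)
  note reassoc = mult_left_cancel_dim[OF UU] mult_left_cancel_dim[OF UW] mult_left_cancel_dim[OF WU]
    mult_left_cancel_dim[OF WW] mult_left_cancel_dim[OF S(1)]
  have "B0 * transpose_mat B0 = four_block_mat (- S) (0\<^sub>m r p) (0\<^sub>m p r) (0\<^sub>m p p)"
    using PKP by (simp add: B0_def transpose_append_rows append_rows_mult_append_cols transpose_mult_dim
      mult_assoc_dim UU UW WU WW reassoc)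
  also have "\<dots> = - four_block_mat S (0\<^sub>m r p) (0\<^sub>m p r) (0\<^sub>m p p)"
    by (intro eq_matI) auto
  finally have 1: "B0 * transpose_mat B0 = - four_block_mat S (0\<^sub>m r p) (0\<^sub>m p r) (0\<^sub>m p p)" .
  have B01: "B0 * transpose_mat B1 = four_block_mat (- H) (- Y) (0\<^sub>m p r) (M * transpose_mat N)"
    using PKP' by (simp add: B0_def B1_def transpose_append_rows append_rows_mult_append_cols transpose_mult_dim
      transpose_add_dim mult_add_distrib_dim mult_assoc_dim UU UW WU WW reassoc add_zero_mat_dim)
  have "B1 * transpose_mat B0 = transpose_mat (B0 * transpose_mat B1)"
    using B by (simp add: transpose_mult_dim)
  also have "\<dots> = four_block_mat (- H) (0\<^sub>m r p) (- transpose_mat Y) (N * transpose_mat M)"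
    unfolding B01 by (subst transpose_four_block_mat[of _ r r _ p _ p])
      (auto simp: transpose_uminus transpose_mult_dim zero_transpose_mat)
  finally have "B0 * transpose_mat B1 + B1 * transpose_mat B0
     = four_block_mat (- H + - H) (- Y) (- transpose_mat Y) (M * transpose_mat N + N * transpose_mat M)"
    unfolding B01 by (simp, subst add_four_block_mat[of _ r r _ p _ p]) (auto simp: add_zero_mat_dim)
  also have "- H + - H = - X" unfolding HH[symmetric] by (intro eq_matI) auto
  also have "M * transpose_mat N + N * transpose_mat M = - Z"
    unfolding Z' by (rule comm_add_mat[of _ p p]) auto
  also have "four_block_mat (- X) (- Y) (- transpose_mat Y) (- Z) = - four_block_mat X Y (transpose_mat Y) Z"
  proof -
    have "dim_row Z = p" "dim_col Z = p"
      using arg_cong[OF Z, of dim_row] arg_cong[OF Z, of dim_col] by simp_all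
    then show ?thesis by (intro eq_matI) auto
  qed
  finally show ?thesis using 1 B by blast
qed

text \<open>A plane with diagonal form 1, -1 on a basis e, f is hyperbolic: e + f and (e - f)/2 are
  isotropic and pair to 1.\<close>

lemma K_mat_diagonalization:
  assumes two: "(2 :: 'a::field) \<noteq> 0"
  shows "\<exists>T :: 'a mat \<in> carrier_mat (2 * m) (2 * m).
    T * mat_diag (2 * m) (\<lambda>i. if i < m then 1 else -1) * transpose_mat T = K_mat m"
proof -
  define H where "H = (1 / 2 :: 'a) \<cdot>\<^sub>m 1\<^sub>m m"
  have H: "H \<in> carrier_mat m m" "transpose_mat H = H"
    by (auto simp: H_def intro!: eq_matI)
  have HH: "H + H = 1\<^sub>m m" using two by (intro eq_matI) (auto simp: H_def field_simps)
  define T where "T = (append_cols (1\<^sub>m m) (1\<^sub>m m) :: 'a mat) @\<^sub>r append_cols H (- H)"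
  note [simp] = H(1)[THEN carrier_matD(1)] H(1)[THEN carrier_matD(2)] H(2)
  have T: "T \<in> carrier_mat (2 * m) (2 * m)" by (auto simp: T_def mult_2)
  have D: "mat_diag (2 * m) (\<lambda>i. if i < m then 1 else -1 :: 'a)
    = append_cols (1\<^sub>m m) (0\<^sub>m m m) @\<^sub>r append_cols (0\<^sub>m m m) (- 1\<^sub>m m)"
    by (intro eq_matI) (auto simp: mat_diag_def append_rows_def append_cols_def)
  have "T * mat_diag (2 * m) (\<lambda>i. if i < m then 1 else -1)
    = append_cols (1\<^sub>m m) (- 1\<^sub>m m) @\<^sub>r append_cols H H"
    unfolding T_def D
    by (simp add: append_rows_mult append_cols_mult_append_rows mult_append_cols)
      (auto simp: append_rows_def append_cols_def intro!: eq_matI)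
  also have "\<dots> * transpose_mat T = K_mat m"
    using HH unfolding T_def K_mat_def
    by (simp add: transpose_append_rows append_rows_mult_append_cols transpose_append_cols
      append_cols_mult_append_rows transpose_uminus mat_minus_self) (auto intro!: eq_matI)
  finally show ?thesis using T by blast
qed

text \<open>Serves to discard, by keeping only the first rows, an auxiliary entry that was added to
  make a determinant a square.\<close>

lemma gram_mat_diag_restrict:
  fixes d :: "nat \<Rightarrow> 'a::comm_ring_1"
  assumes "E \<in> carrier_mat (a + b) c" "E * transpose_mat E = mat_diag (a + b) d"
  shows "\<exists>E' \<in> carrier_mat a c. E' * transpose_mat E' = mat_diag a d"
proof -
  obtain A B where AB: "A \<in> carrier_mat a c" "B \<in> carrier_mat b c" "E = A @\<^sub>r B"
    using append_rows_split[OF assms(1)] .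
  then have "four_block_mat (A * transpose_mat A) (A * transpose_mat B) (B * transpose_mat A) (B * transpose_mat B)
    = four_block_mat (mat_diag a d) (0\<^sub>m a b) (0\<^sub>m b a) (mat_diag b (\<lambda>i. d (a + i)))"
    unfolding mat_diag_add[symmetric] assms(2)[symmetric] by (simp add: transpose_append_rows append_rows_mult_append_cols)
  then have "A * transpose_mat A = mat_diag a d"
    using AB by (subst (asm) four_block_mat_eq_iff[of _ a a _ b b]) auto
  then show ?thesis using AB by blast
qed

text \<open>The length \<open>l\<close> suffices: with the \<open>m\<close> planes diagonalised as 1
  and -1, the orthogonal sum becomes a diagonal form, and \<open>gram_mat_diag\<close> applies once
  its determinant is a square.\<close>

lemma exists_hyperbolic_frame:
  fixes \<sigma> :: "nat \<Rightarrow> 'a::{field,finite}"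
  assumes two: "(2 :: 'a) \<noteq> 0" and nz: "\<And>i. i < r \<Longrightarrow> \<sigma> i \<noteq> 0"
    and l: "l = (if (-1) ^ (r + m) * (\<Prod>i<r. \<sigma> i) \<in> nonzero_squares then r + 2 * m else r + 2 * m + 1)"
  shows "\<exists>E \<in> carrier_mat (r + 2 * m) l. E * transpose_mat E
    = four_block_mat (- mat_diag r \<sigma>) (0\<^sub>m r (2 * m)) (0\<^sub>m (2 * m) r) (K_mat m)"
proof -
  \<comment> \<open>If \<open>\<delta>\<close> is not a square, the extra diagonal entry \<open>\<delta>\<close> makes the determinant \<open>\<delta>\<^sup>2\<close>.\<close>
  define \<delta> where "\<delta> = (-1) ^ (r + m) * (\<Prod>i<r. \<sigma> i)"
  define d where "d i = (if i < r then - \<sigma> i else if i < r + m then 1 else if i < r + 2 * m then -1 else \<delta>)" for i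
  have "\<delta> \<noteq> 0" using nz by (simp add: \<delta>_def)
  \<comment> \<open>The signs come from the \<open>r\<close> negated entries and the
    \<open>m\<close> entries -1; the product is extended over one block of indices after the
    other.\<close>
  have d1: "(\<Prod>i<r + 2 * m. d i) = \<delta>"
  proof -
    have "(\<Prod>i<r + m + k. d i) = (-1) ^ (r + k) * (\<Prod>i<r. \<sigma> i)" if "k \<le> m" for k
      using that
    proof (induction k)
      case 0
      have "(\<Prod>i<r + j. d i) = (-1) ^ r * (\<Prod>i<r. \<sigma> i)" if "j \<le> m" for j
        using that
      proof (induction j)
        case 0
        have "(\<Prod>i<r. d i) = (\<Prod>i<r. (-1) * \<sigma> i)" by (intro prod.cong) (auto simp: d_def)
        then show ?case by (simp only: prod.distrib) simp
      qed (auto simp: d_def)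
      then show ?case by simp
    next
      case (Suc k)
      then show ?case by (simp add: d_def)
    qed
    from this[of m] show ?thesis by (simp add: \<delta>_def mult_2 add.assoc)
  qed
  obtain E0 where E0: "E0 \<in> carrier_mat (r + 2 * m) l" "E0 * transpose_mat E0 = mat_diag (r + 2 * m) d"
  proof (cases "\<delta> \<in> nonzero_squares")
    case True
    then show ?thesis using that gram_mat_diag[of d "r + 2 * m"] l d1 by (auto simp: \<delta>_def)
  next
    case False
    then have l': "l = (r + 2 * m) + 1" using l by (simp add: \<delta>_def)
    have "(\<Prod>i<l. d i) = \<delta>\<^sup>2" using d1 unfolding l' by (simp add: d_def power2_eq_square)
    then have "(\<Prod>i<l. d i) \<in> nonzero_squares" using \<open>\<delta> \<noteq> 0\<close> by (auto simp: nonzero_squares_def)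
    then obtain E1 where "E1 \<in> carrier_mat l l" "E1 * transpose_mat E1 = mat_diag l d"
      using gram_mat_diag by blast
    then show ?thesis using that gram_mat_diag_restrict[of E1 "r + 2 * m" 1 l d] l' by auto
  qed
  obtain T :: "'a mat" where T: "T \<in> carrier_mat (2 * m) (2 * m)"
    "T * mat_diag (2 * m) (\<lambda>i. if i < m then 1 else -1) * transpose_mat T = K_mat m"
    using K_mat_diagonalization[OF two] by blast
  define F where "F = four_block_mat (1\<^sub>m r) (0\<^sub>m r (2 * m)) (0\<^sub>m (2 * m) r) T"
  have F: "F \<in> carrier_mat (r + 2 * m) (r + 2 * m)"
    unfolding F_def using T by auto
  have d2: "mat_diag r d = - mat_diag r \<sigma>"
    "mat_diag (2 * m) (\<lambda>i. d (r + i)) = mat_diag (2 * m) (\<lambda>i. if i < m then 1 else -1)"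
    by (auto simp: d_def mat_diag_def intro!: eq_matI)
  have "(F * E0) * transpose_mat (F * E0) = F * (E0 * transpose_mat E0) * transpose_mat F"
    using F E0(1) by (simp add: mult_assoc_dim transpose_mult_dim)
  also have "\<dots> = four_block_mat (- mat_diag r \<sigma>) (0\<^sub>m r (2 * m)) (0\<^sub>m (2 * m) r) (K_mat m)"
    unfolding E0(2) mat_diag_add F_def d2
    by (subst gram_four_block_diag[of _ r r _ _ "2 * m" "2 * m"])
      (use T in \<open>auto simp: mat_diag_def\<close>)
  finally show ?thesis using F E0(1) by (intro bexI[of _ "F * E0"]) auto
qed

section \<open>Codes and Gram matrices\<close>

lemma code_generated_by_carrier:
  fixes V :: "'a::comm_ring_1 dual vec set"
  assumes "V \<subseteq> carrier_vec n"
  shows "code_generated_by n V \<subseteq> carrier_vec n" "V \<subseteq> code_generated_by n V"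
proof -
  interpret vec_module "TYPE('a dual)" n .
  show "code_generated_by n V \<subseteq> carrier_vec n" "V \<subseteq> code_generated_by n V"
    unfolding code_generated_by_def using span_is_subset2[OF assms] in_own_span[OF assms] by auto
qed

text \<open>The vectors orthogonal to \<open>y\<close> form a submodule; it contains the generators,
  hence their span.\<close>

lemma code_generated_by_orthogonal:
  fixes V :: "'a::comm_ring_1 dual vec set"
  assumes V: "V \<subseteq> carrier_vec n" and y: "y \<in> carrier_vec n"
    and orth: "\<And>v. v \<in> V \<Longrightarrow> v \<bullet> y = 0" and x: "x \<in> code_generated_by n V"
  shows "x \<bullet> y = 0"
proof -
  interpret vec_module "TYPE('a dual)" n .
  let ?N = "{x \<in> carrier_vec n. x \<bullet> y = 0}"
  have "submodule class_ring ?N (module_vec TYPE('a dual) n)"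
    unfolding submodule_def using y module_axioms
    by (auto simp: module_vec_simps class_ring_simps add_scalar_prod_distrib[of _ n] smult_scalar_prod_distrib[of _ n])
  then have "span V \<subseteq> ?N"
    using V orth by (intro span_is_subset) auto
  then show ?thesis using x unfolding code_generated_by_def by auto
qed

text \<open>Orthogonality passes from the rows to their span in one argument at a time, with the
  symmetry of the dot product in between.\<close>

lemma self_orthogonal_code_generated_by_iff:
  fixes A :: "'a::comm_ring_1 dual mat"
  assumes A: "A \<in> carrier_mat k n"
  shows "self_orthogonal (code_generated_by n (set (rows A))) \<longleftrightarrow> A * transpose_mat A = 0\<^sub>m k k"
proof
  have V: "set (rows A) \<subseteq> carrier_vec n" using A rows_carrier[of A] by simp
  note gen = code_generated_by_carrier[OF V]
  have rows: "set (rows A) = {row A i | i. i < k}" using A by (auto simp: rows_def)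
  show "A * transpose_mat A = 0\<^sub>m k k" if so: "self_orthogonal (code_generated_by n (set (rows A)))"
  proof (rule eq_matI)
    fix i j assume "i < dim_row (0\<^sub>m k k :: 'a dual mat)" "j < dim_col (0\<^sub>m k k :: 'a dual mat)"
    then have ij: "i < k" "j < k" by auto
    then have "row A i \<in> code_generated_by n (set (rows A))" "row A j \<in> code_generated_by n (set (rows A))"
      using gen(2) rows by auto
    then have "row A i \<bullet> row A j = 0" using so by (auto simp: self_orthogonal_def)
    then show "(A * transpose_mat A) $$ (i, j) = 0\<^sub>m k k $$ (i, j)" using ij A by simp
  qed (use A in auto)
  show "self_orthogonal (code_generated_by n (set (rows A)))" if AA: "A * transpose_mat A = 0\<^sub>m k k"
    unfolding self_orthogonal_def
  proof (intro ballI)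
    fix x y assume x: "x \<in> code_generated_by n (set (rows A))" and y: "y \<in> code_generated_by n (set (rows A))"
    have rr: "v \<bullet> w = 0" if "v \<in> set (rows A)" "w \<in> set (rows A)" for v w
    proof -
      obtain i j where "v = row A i" "w = row A j" "i < k" "j < k" using \<open>v \<in> _\<close> \<open>w \<in> _\<close> rows by auto
      then show ?thesis using arg_cong[OF AA, of "\<lambda>M. M $$ (i, j)"] A by simp
    qed
    have "v \<bullet> y = 0" if v: "v \<in> set (rows A)" for v
    proof -
      have "y \<bullet> v = 0" using V v rr y by (intro code_generated_by_orthogonal[OF V _ _ y]) auto
      then show ?thesis using V v gen(1) y by (metis comm_scalar_prod subsetD)
    qed
    then show "x \<bullet> y = 0" using gen(1) y by (intro code_generated_by_orthogonal[OF V _ _ x]) auto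
  qed
qed

text \<open>The rows of one generator matrix are codewords, hence combinations of the rows of the
  other; the coefficient vectors are the rows of \<open>T\<close>.\<close>

lemma generator_matrix_change:
  assumes G: "generator_matrix n C G" and G': "generator_matrix n C G'"
  shows "\<exists>T \<in> carrier_mat (dim_row G') (dim_row G). G' = T * G"
proof -
  obtain k1 k2 where k: "G \<in> carrier_mat (k1 + k2) n"
    and comb: "\<forall>c\<in>C. \<exists>!p. fst p \<in> carrier_vec k1 \<and> snd p \<in> carrier_vec k2 \<and>
           c = transpose_mat G *\<^sub>v (fst p @\<^sub>v map_vec of_base (snd p))"
    using G unfolding generator_matrix_def by blast
  have dims: "dim_row G = k1 + k2" "dim_col G = n" "dim_col G' = n"
    using k G' unfolding generator_matrix_def by auto
  have "\<exists>x \<in> carrier_vec (dim_row G). row G' i = transpose_mat G *\<^sub>v x" if "i < dim_row G'" for i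
  proof -
    have "row G' i \<in> C" using G' that unfolding generator_matrix_def by auto
    then obtain p where "fst p \<in> carrier_vec k1" "snd p \<in> carrier_vec k2"
      "row G' i = transpose_mat G *\<^sub>v (fst p @\<^sub>v map_vec of_base (snd p))"
      using comb by blast
    then show ?thesis using k by (intro bexI[of _ "fst p @\<^sub>v map_vec of_base (snd p)"]) auto
  qed
  then obtain x where x: "\<And>i. i < dim_row G' \<Longrightarrow> x i \<in> carrier_vec (dim_row G)"
    "\<And>i. i < dim_row G' \<Longrightarrow> row G' i = transpose_mat G *\<^sub>v x i"
    by metis
  define T where "T = mat (dim_row G') (dim_row G) (\<lambda>(i, j). x i $ j)"
  have "G' = T * G"
  proof (rule eq_matI)
    fix i j assume "i < dim_row (T * G)" "j < dim_col (T * G)"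
    then have ij: "i < dim_row G'" "j < n" by (auto simp: T_def dims)
    have "row T i = x i" using ij x(1)[OF ij(1)] by (intro eq_vecI) (auto simp: T_def)
    then have "(T * G) $$ (i, j) = x i \<bullet> col G j" using ij by (simp add: T_def dims)
    also have "\<dots> = col G j \<bullet> x i"
      using x(1)[OF ij(1)] ij dims by (intro comm_scalar_prod[of _ "dim_row G"]) (auto intro: carrier_vecI)
    also have "\<dots> = row G' i $ j" using x(2)[OF ij(1)] ij dims by simp
    finally show "G' $$ (i, j) = (T * G) $$ (i, j)" using ij dims by simp
  qed (auto simp: T_def dims)
  then show ?thesis by (intro bexI[of _ T]) (auto simp: T_def)
qed

section \<open>Matrices over \<open>R\<close> as pairs of matrices over the base ring\<close>

lemma dual_parts [simp]:
  fixes x y :: "'a::comm_ring_1 dual"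
  shows "base_part (x + y) = base_part x + base_part y" "u_part (x + y) = u_part x + u_part y"
    "base_part (- x) = - base_part x" "u_part (- x) = - u_part x"
    "base_part (0 :: 'a dual) = 0" "u_part (0 :: 'a dual) = 0"
    "base_part (x * y) = base_part x * base_part y"
    "u_part (x * y) = base_part x * u_part y + u_part x * base_part y"
  by (simp_all add: plus_dual_def uminus_dual_def zero_dual_def times_dual_def)

lemma dual_parts_sum:
  fixes f :: "'b \<Rightarrow> 'a::comm_ring_1 dual"
  shows "base_part (sum f S) = (\<Sum>i\<in>S. base_part (f i))" "u_part (sum f S) = (\<Sum>i\<in>S. u_part (f i))"
  by (induction S rule: infinite_finite_induct; simp)+

text \<open>The matrix \<open>A + uB\<close>, see \<open>dual_mat_of_base\<close>. The shape is read
  off from \<open>A\<close>; \<open>B\<close> is meant to have the same.\<close>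

definition dual_mat :: "'a mat \<Rightarrow> 'a mat \<Rightarrow> 'a dual mat" where
  "dual_mat A B = mat (dim_row A) (dim_col A) (\<lambda>ij. Dual (A $$ ij) (B $$ ij))"

lemma dual_mat_of_base:
  fixes A B :: "'a::comm_ring_1 mat"
  assumes "A \<in> carrier_mat p q" "B \<in> carrier_mat p q"
  shows "map_mat of_base A + dual_u \<cdot>\<^sub>m map_mat of_base B = dual_mat A B"
  using assms
  by (intro eq_matI) (auto simp: dual_mat_def of_base_def dual_u_def plus_dual_def times_dual_def)

lemma dual_mat_surj:
  assumes "B \<in> carrier_mat p q"
  obtains B0 B1 where "B0 \<in> carrier_mat p q" "B1 \<in> carrier_mat p q" "B = dual_mat B0 B1"
proof
  show "map_mat base_part B \<in> carrier_mat p q" "map_mat u_part B \<in> carrier_mat p q" using assms by auto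
  show "B = dual_mat (map_mat base_part B) (map_mat u_part B)"
    using assms by (intro eq_matI) (auto simp: dual_mat_def)
qed

lemma dual_mat_dim [simp]:
  "dim_row (dual_mat A B) = dim_row A" "dim_col (dual_mat A B) = dim_col A"
  by (simp_all add: dual_mat_def)

lemma dual_mat_eq_iff:
  assumes "A \<in> carrier_mat p q" "B \<in> carrier_mat p q" "A' \<in> carrier_mat p q" "B' \<in> carrier_mat p q"
  shows "dual_mat A B = dual_mat A' B' \<longleftrightarrow> A = A' \<and> B = B'"
proof
  assume eq: "dual_mat A B = dual_mat A' B'"
  have "A $$ (i, j) = A' $$ (i, j) \<and> B $$ (i, j) = B' $$ (i, j)" if "i < p" "j < q" for i j
    using arg_cong[OF eq, of "\<lambda>M. M $$ (i, j)"] that assms by (simp add: dual_mat_def)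
  then show "A = A' \<and> B = B'" using assms by (auto intro!: eq_matI)
qed auto

text \<open>The term quadratic in \<open>B1\<close> vanishes because \<open>u\<close> squares to
  0.\<close>

lemma dual_mat_gram:
  fixes B0 B1 :: "'a::comm_ring_1 mat"
  assumes "B0 \<in> carrier_mat p q" "B1 \<in> carrier_mat p q"
  shows "dual_mat B0 B1 * transpose_mat (dual_mat B0 B1)
    = dual_mat (B0 * transpose_mat B0) (B0 * transpose_mat B1 + B1 * transpose_mat B0)"
  using assms
  by (intro eq_matI)
    (auto simp: dual_mat_def scalar_prod_def dual_parts_sum sum.distrib intro!: dual.expand)

lemma append_cols_gram:
  fixes G B :: "'a::comm_ring_1 mat"
  assumes "dim_row G = dim_row B"
  shows "append_cols G B * transpose_mat (append_cols G B) = G * transpose_mat G + B * transpose_mat B"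
  using assms by (simp add: transpose_append_cols append_cols_mult_append_rows)

text \<open>By \<open>dual_mat_gram\<close>, the condition that \<open>l\<close> added columns
  \<open>B0 + u B1\<close> cancel the Gram matrix \<open>A0 + u A1\<close>, split into its two
  components.\<close>

definition gram_pair :: "nat \<Rightarrow> nat \<Rightarrow> 'a::comm_ring_1 mat \<Rightarrow> 'a mat \<Rightarrow> bool" where
  "gram_pair k l A0 A1 \<longleftrightarrow> (\<exists>B0 \<in> carrier_mat k l. \<exists>B1 \<in> carrier_mat k l.
     B0 * transpose_mat B0 = - A0 \<and> B0 * transpose_mat B1 + B1 * transpose_mat B0 = - A1)"

text \<open>Two generator matrices satisfy \<open>G = T H\<close>, so a matrix \<open>B\<close> completing \<open>H\<close> yields \<open>T B\<close> completing
  \<open>G\<close>: the possible lengths can be read off a single generator matrix.\<close>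

lemma self_orthogonal_embedding_iff:
  fixes G :: "'a::comm_ring_1 dual mat"
  assumes G: "generator_matrix n C G" and k: "k = dim_row G"
    and A: "A0 \<in> carrier_mat k k" "A1 \<in> carrier_mat k k"
    and GG: "G * transpose_mat G = dual_mat A0 A1"
  shows "(\<exists>D. self_orthogonal_embedding n C N D) \<longleftrightarrow>
    (\<exists>l. N = n + l \<and> gram_pair k l A0 A1)"
    (is "_ \<longleftrightarrow> (\<exists>l. N = n + l \<and> ?Q l)")
proof -
  have sum_zero: "M + M' = 0\<^sub>m p p \<longleftrightarrow> M' = - M" if "M \<in> carrier_mat p p" "M' \<in> carrier_mat p p"
    for p and M M' :: "'a dual mat"
  proof
    assume eq: "M + M' = 0\<^sub>m p p"
    have "M' $$ (i, j) = - M $$ (i, j)" if "i < p" "j < p" for i j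
      using arg_cong[OF eq, of "\<lambda>X. X $$ (i, j)"] that \<open>M \<in> _\<close> \<open>M' \<in> _\<close>
      by (simp add: eq_neg_iff_add_eq_0 add.commute)
    then show "M' = - M" using that by (intro eq_matI) auto
  next
    assume "M' = - M" then show "M + M' = 0\<^sub>m p p" using that by (auto intro!: eq_matI)
  qed
  \<comment> \<open>Juxtaposing columns adds Gram matrices, so the new columns have to cancel the
    Gram matrix of \<open>H\<close>.\<close>
  have embed: "self_orthogonal (code_generated_by (n + l) (set (rows (append_cols H B))))
      \<longleftrightarrow> B * transpose_mat B = - (H * transpose_mat H)"
    if H: "generator_matrix n C H" and B: "B \<in> carrier_mat (dim_row H) l" for H l and B :: "'a dual mat"
  proof -
    let ?p = "dim_row H"
    have H: "H \<in> carrier_mat ?p n" using H unfolding generator_matrix_def by auto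
    have "self_orthogonal (code_generated_by (n + l) (set (rows (append_cols H B))))
        \<longleftrightarrow> H * transpose_mat H + B * transpose_mat B = 0\<^sub>m ?p ?p"
      using self_orthogonal_code_generated_by_iff[OF append_cols_carrier[OF H B]] B
      by (simp add: append_cols_gram)
    also have "\<dots> \<longleftrightarrow> B * transpose_mat B = - (H * transpose_mat H)"
      by (rule sum_zero; rule mult_carrier_mat[OF H] mult_carrier_mat[OF B]; simp only: transpose_carrier_mat H B)
    finally show ?thesis .
  qed
  have Q: "?Q l \<longleftrightarrow> (\<exists>B \<in> carrier_mat k l. B * transpose_mat B = - (G * transpose_mat G))" for l
  proof -
    have neg: "- dual_mat A0 A1 = dual_mat (- A0) (- A1)"
      using A by (intro eq_matI) (auto simp: dual_mat_def intro!: dual.expand)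
    have "dual_mat B0 B1 * transpose_mat (dual_mat B0 B1) = - (G * transpose_mat G) \<longleftrightarrow>
        B0 * transpose_mat B0 = - A0 \<and> B0 * transpose_mat B1 + B1 * transpose_mat B0 = - A1"
      if "B0 \<in> carrier_mat k l" "B1 \<in> carrier_mat k l" for B0 B1
      unfolding GG neg dual_mat_gram[OF that] using that A
      by (intro dual_mat_eq_iff[of _ k k]) auto
    moreover have "dual_mat B0 B1 \<in> carrier_mat k l" if "B0 \<in> carrier_mat k l" for B0 B1
      using that by auto
    ultimately show ?thesis unfolding gram_pair_def using dual_mat_surj by metis
  qed
  show ?thesis
  proof
    assume "\<exists>D. self_orthogonal_embedding n C N D"
    then obtain H B l where N: "N = n + l" and H: "generator_matrix n C H"
      and B: "B \<in> carrier_mat (dim_row H) l"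
      and "self_orthogonal (code_generated_by (n + l) (set (rows (append_cols H B))))"
      unfolding self_orthogonal_embedding_def by blast
    then have BB: "B * transpose_mat B = - (H * transpose_mat H)" using embed by blast
    obtain T where T: "T \<in> carrier_mat k (dim_row H)" and GT: "G = T * H"
      using generator_matrix_change[OF H G] k by auto
    have "(T * B) * transpose_mat (T * B) = T * (B * transpose_mat B) * transpose_mat T"
      using T B by (simp add: mult_assoc_dim transpose_mult_dim)
    also have "\<dots> = - (G * transpose_mat G)"
      unfolding BB GT using T B by (simp add: mult_assoc_dim transpose_mult_dim)
    finally have "?Q l" using T B by (subst Q) (auto intro!: bexI[of _ "T * B"])
    then show "\<exists>l. N = n + l \<and> ?Q l" using N by blast
  next
    assume "\<exists>l. N = n + l \<and> ?Q l"
    then obtain l B where N: "N = n + l" and B: "B \<in> carrier_mat k l"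
      and "B * transpose_mat B = - (G * transpose_mat G)" using Q by auto
    then have "self_orthogonal (code_generated_by (n + l) (set (rows (append_cols G B))))"
      using embed[OF G] k by auto
    then have "self_orthogonal_embedding n C N (code_generated_by N (set (rows (append_cols G B))))"
      unfolding self_orthogonal_embedding_def using N G B k by blast
    then show "\<exists>D. self_orthogonal_embedding n C N D" by blast
  qed
qed

section \<open>Congruence invariance and the lower bound in normal form\<close>

lemma mat_inverse_obtain:
  assumes "P \<in> carrier_mat k k" "invertible_mat P"
  obtains P' where "P' \<in> carrier_mat k k" "P' * P = 1\<^sub>m k"
proof -
  obtain P' where P': "P * P' = 1\<^sub>m (dim_row P)" "P' * P = 1\<^sub>m (dim_row P')"
    using assms(2) unfolding invertible_mat_def inverts_mat_def by blast
  have "dim_col P' = k" "dim_row P' = k"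
    using arg_cong[OF P'(1), of dim_col] arg_cong[OF P'(2), of dim_col] assms(1) by auto
  then show thesis using that[of P'] P' by auto
qed

text \<open>Row operations act on the added columns as well: \<open>P * B0\<close> and
  \<open>P * B1\<close> are the new witnesses.\<close>

lemma gram_pair_congruence:
  assumes P: "P \<in> carrier_mat k k" and A: "A0 \<in> carrier_mat k k" "A1 \<in> carrier_mat k k"
    and "gram_pair k l A0 A1"
  shows "gram_pair k l (P * A0 * transpose_mat P) (P * A1 * transpose_mat P)"
proof -
  obtain B0 B1 where B: "B0 \<in> carrier_mat k l" "B1 \<in> carrier_mat k l"
    and 0: "B0 * transpose_mat B0 = - A0" and 1: "B0 * transpose_mat B1 + B1 * transpose_mat B0 = - A1"
    using assms(4) unfolding gram_pair_def by blast
  note [simp] = P[THEN carrier_matD(1)] P[THEN carrier_matD(2)] A[THEN carrier_matD(1)]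
    A[THEN carrier_matD(2)] B[THEN carrier_matD(1)] B[THEN carrier_matD(2)]
  have "(P * B0) * transpose_mat (P * B0) = P * (B0 * transpose_mat B0) * transpose_mat P"
    by (simp add: mult_assoc_dim transpose_mult_dim)
  also have "\<dots> = - (P * A0 * transpose_mat P)" unfolding 0 by simp
  finally have 2: "(P * B0) * transpose_mat (P * B0) = - (P * A0 * transpose_mat P)" .
  have "(P * B0) * transpose_mat (P * B1) + (P * B1) * transpose_mat (P * B0)
      = P * (B0 * transpose_mat B1 + B1 * transpose_mat B0) * transpose_mat P"
    by (simp add: mat_ring_dim)
  also have "\<dots> = - (P * A1 * transpose_mat P)" unfolding 1 by simp
  finally have 3: "(P * B0) * transpose_mat (P * B1) + (P * B1) * transpose_mat (P * B0)
    = - (P * A1 * transpose_mat P)" .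
  have "P * B0 \<in> carrier_mat k l" "P * B1 \<in> carrier_mat k l" by (auto intro: carrier_matI)
  then show ?thesis unfolding gram_pair_def using 2 3 by blast
qed

text \<open>The converse is the same transport along the inverse of \<open>P\<close>. Thus the
  admissible lengths can be computed in normal form.\<close>

lemma gram_pair_congruence_iff:
  assumes P: "P \<in> carrier_mat k k" "invertible_mat P"
    and A: "A0 \<in> carrier_mat k k" "A1 \<in> carrier_mat k k"
  shows "gram_pair k l (P * A0 * transpose_mat P) (P * A1 * transpose_mat P) \<longleftrightarrow> gram_pair k l A0 A1"
proof
  obtain P' where P': "P' \<in> carrier_mat k k" "P' * P = 1\<^sub>m k"
    using mat_inverse_obtain[OF P] .
  note [simp] = P(1)[THEN carrier_matD(1)] P(1)[THEN carrier_matD(2)] A[THEN carrier_matD(1)]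
    A[THEN carrier_matD(2)] P'(1)[THEN carrier_matD(1)] P'(1)[THEN carrier_matD(2)]
  have cancel: "P' * (P * A * transpose_mat P) * transpose_mat P' = A"
    if dims: "dim_row A = k" "dim_col A = k" for A
  proof -
    have "P' * (P * A * transpose_mat P) * transpose_mat P' = (P' * P) * A * transpose_mat (P' * P)"
      using dims by (simp add: mult_assoc_dim transpose_mult_dim)
    then show ?thesis using dims by (simp add: P'(2))
  qed
  have "P * A * transpose_mat P \<in> carrier_mat k k" if "dim_row A = k" "dim_col A = k" for A
    by (auto intro: carrier_matI)
  then show "gram_pair k l A0 A1"
    if "gram_pair k l (P * A0 * transpose_mat P) (P * A1 * transpose_mat P)"
    using gram_pair_congruence[OF P'(1) _ _ that] by (simp add: cancel)
qed (rule gram_pair_congruence[OF P(1) A])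

text \<open>The first \<open>r\<close> rows of \<open>B0\<close> and the remaining ones supply
  \<open>U\<close> and \<open>V\<close> for \<open>isotropic_lower_bound\<close>. If the signed
  determinant is not a square, equality of lengths is excluded, which forces one more
  column.\<close>

lemma gram_pair_lower_bound:
  fixes S T X Y Z :: "'a::field mat"
  assumes carr: "S \<in> carrier_mat r r" "T \<in> carrier_mat r r" "X \<in> carrier_mat r r"
      "Y \<in> carrier_mat r p" "Z \<in> carrier_mat p p"
    and S: "T * S = 1\<^sub>m r" "det S \<noteq> 0"
    and gp: "gram_pair (r + p) l (four_block_mat S (0\<^sub>m r p) (0\<^sub>m p r) (0\<^sub>m p p))
      (four_block_mat X Y (transpose_mat Y) Z)"
  shows "(if (-1) ^ (r + mu (- Z)) * det S \<in> nonzero_squares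
    then r + 2 * mu (- Z) else r + 2 * mu (- Z) + 1) \<le> l"
proof -
  obtain B0 B1 where B: "B0 \<in> carrier_mat (r + p) l" "B1 \<in> carrier_mat (r + p) l"
    and 0: "B0 * transpose_mat B0 = - four_block_mat S (0\<^sub>m r p) (0\<^sub>m p r) (0\<^sub>m p p)"
    and 1: "B0 * transpose_mat B1 + B1 * transpose_mat B0 = - four_block_mat X Y (transpose_mat Y) Z"
    using gp unfolding gram_pair_def by blast
  obtain U V where UV: "U \<in> carrier_mat r l" "V \<in> carrier_mat p l" "B0 = U @\<^sub>r V"
    using append_rows_split[OF B(1)] .
  obtain U1 V1 where UV1: "U1 \<in> carrier_mat r l" "V1 \<in> carrier_mat p l" "B1 = U1 @\<^sub>r V1"
    using append_rows_split[OF B(2)] .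
  note carrs = carr UV(1,2) UV1(1,2)
  note [simp] = carrs[THEN carrier_matD(1)] carrs[THEN carrier_matD(2)]
  have neg: "- four_block_mat A B C D = four_block_mat (- A) (- B) (- C) (- D)"
    if "dim_row A = r" "dim_col A = r" "dim_row D = p" "dim_col D = p" "dim_row B = r" "dim_col B = p"
      "dim_row C = p" "dim_col C = r" for A B C D :: "'a mat"
    using that by (intro eq_matI) auto
  have "four_block_mat (U * transpose_mat U) (U * transpose_mat V) (V * transpose_mat U) (V * transpose_mat V)
      = B0 * transpose_mat B0"
    unfolding UV(3) by (simp add: transpose_append_rows append_rows_mult_append_cols)
  also have "\<dots> = four_block_mat (- S) (- 0\<^sub>m r p) (- 0\<^sub>m p r) (- 0\<^sub>m p p)"
    unfolding 0 by (rule neg) simp_all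
  finally have "U * transpose_mat U = - S \<and> U * transpose_mat V = - 0\<^sub>m r p \<and>
      V * transpose_mat U = - 0\<^sub>m p r \<and> V * transpose_mat V = - 0\<^sub>m p p"
    by (subst (asm) four_block_mat_eq_iff[of _ r r _ p p]) (auto intro: carrier_matI)
  moreover have zero: "- 0\<^sub>m a b = (0\<^sub>m a b :: 'a mat)" for a b by (rule eq_matI) auto
  ultimately have UU: "U * transpose_mat U = - S" and UV0: "U * transpose_mat V = 0\<^sub>m r p"
    and VV: "V * transpose_mat V = 0\<^sub>m p p" by simp_all
  have VV1: "V * transpose_mat V1 + V1 * transpose_mat V = - Z"
  proof (rule eq_matI)
    fix i j assume "i < dim_row (- Z)" "j < dim_col (- Z)"
    then have ij: "i < p" "j < p" by auto
    then have "(B0 * transpose_mat B1 + B1 * transpose_mat B0) $$ (r + i, r + j) = (- Z) $$ (i, j)"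
      unfolding 1 by simp
    then show "(V * transpose_mat V1 + V1 * transpose_mat V) $$ (i, j) = (- Z) $$ (i, j)"
      using ij unfolding UV(3) UV1(3) by (simp add: row_append_rows)
  qed simp_all
  note lower = isotropic_lower_bound[OF carr(1,2) UV(1,2) UV1(2) carr(5) S UU UV0 VV VV1]
  show ?thesis
  proof (cases "(-1) ^ (r + mu (- Z)) * det S \<in> nonzero_squares")
    case False
    then have "l \<noteq> r + 2 * mu (- Z)" using lower(2) by blast
    then show ?thesis using lower(1) False by simp
  qed (use lower(1) in simp)
qed

text \<open>Brings both shapes of \<open>S\<close> into the uniform diagonal form on which the frame
  construction operates.\<close>

lemma normal_form_mat_diag:
  fixes S :: "'a::field mat"
  assumes "S = 1\<^sub>m r \<or> (r \<ge> 1 \<and> (\<exists>z. z \<noteq> 0 \<and> z \<notin> nonzero_squares \<and>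
    S = diag_block_mat [1\<^sub>m (r - 1), mat 1 1 (\<lambda>_. z)]))"
  obtains \<sigma> where "S = mat_diag r \<sigma>" "\<And>i. i < r \<Longrightarrow> \<sigma> i \<noteq> 0"
  using assms
proof (elim disjE conjE exE)
  assume "S = 1\<^sub>m r"
  then show thesis by (intro that[of "\<lambda>_. 1"]) auto
next
  fix z :: 'a assume *: "r \<ge> 1" "z \<noteq> 0" "S = diag_block_mat [1\<^sub>m (r - 1), mat 1 1 (\<lambda>_. z)]"
  have "S = mat_diag r (\<lambda>i. if i = r - 1 then z else 1)"
    unfolding *(3) using *(1) by (intro eq_matI) (auto simp: mat_diag_def Let_def)
  then show thesis using *(2) by (intro that[of "\<lambda>i. if i = r - 1 then z else 1"]) auto
qed

text \<open>A Gram matrix is symmetric, and transposition acts on the two components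
  separately.\<close>

lemma symmetric_of_dual_gram:
  fixes G :: "'a::comm_ring_1 dual mat"
  assumes "A0 \<in> carrier_mat k k" "A1 \<in> carrier_mat k k" "G * transpose_mat G = dual_mat A0 A1"
  shows "transpose_mat A1 = A1"
proof -
  have "dual_mat (transpose_mat A0) (transpose_mat A1) = transpose_mat (dual_mat A0 A1)"
    using assms(1,2) by (intro eq_matI) (auto simp: dual_mat_def)
  also have "\<dots> = dual_mat A0 A1"
    unfolding assms(3)[symmetric] by (simp add: transpose_mult_dim)
  finally show ?thesis
    using dual_mat_eq_iff[of "transpose_mat A0" k k "transpose_mat A1" A0 A1] assms by simp
qed

section \<open>The minimal length from the least admissible number of added columns\<close>

theorem theorem4p3:
  fixes C :: "'a::{field,finite} dual vec set"
    and G :: "'a dual mat"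
    and A0 A1 P S X Y Z :: "'a mat"
    and n k r m :: nat
  assumes "odd (card (UNIV :: 'a set))"
    and "linear_code n C"
    and "generator_matrix n C G"
    and "k = dim_row G"
    and "A0 \<in> carrier_mat k k" and "A1 \<in> carrier_mat k k"
    and "G * transpose_mat G = map_mat of_base A0 + dual_u \<cdot>\<^sub>m map_mat of_base A1"
    and "r = vec_space.rank k A0"
    and "P \<in> carrier_mat k k" and "invertible_mat P"
    and "P * A0 * transpose_mat P = diag_block_mat [S, 0\<^sub>m (k - r) (k - r)]"
    and "S = 1\<^sub>m r \<or>
         (r \<ge> 1 \<and> (\<exists>z. z \<noteq> 0 \<and> z \<notin> nonzero_squares \<and>
            S = diag_block_mat [1\<^sub>m (r - 1), mat 1 1 (\<lambda>_. z)]))"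
    and "X \<in> carrier_mat r r" and "transpose_mat X = X"
    and "Y \<in> carrier_mat r (k - r)" and "Z \<in> carrier_mat (k - r) (k - r)"
    and "P * A1 * transpose_mat P = four_block_mat X Y (transpose_mat Y) Z"
    and "m = mu (- Z)"
  shows "n_s n C =
    (if (-1) ^ (r + m) * det S \<in> nonzero_squares then n + r + 2 * m else n + r + 2 * m + 1)"
proof -
  have two: "(2 :: 'a) \<noteq> 0" using assms(1) by (rule two_neq_zero_odd_card)
  obtain \<sigma> where S: "S = mat_diag r \<sigma>" and \<sigma>: "\<And>i. i < r \<Longrightarrow> \<sigma> i \<noteq> 0"
    using normal_form_mat_diag[OF assms(12)] by blast
  define T where "T = mat_diag r (\<lambda>i. inverse (\<sigma> i))"
  have ST: "S \<in> carrier_mat r r" "T \<in> carrier_mat r r" by (simp_all add: S T_def)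
  have ST1: "S * T = 1\<^sub>m r" "T * S = 1\<^sub>m r" "transpose_mat S = S" "transpose_mat T = T"
    unfolding S T_def mat_diag_diag using \<sigma> by (auto simp: mat_diag_def intro!: eq_matI)
  have detS: "det S = (\<Prod>i<r. \<sigma> i)" "det S \<noteq> 0" unfolding S det_mat_diag using \<sigma> by auto
  define p where "p = k - r"
  note Y = assms(15)[folded p_def] and Z = assms(16)[folded p_def]
  have PA0: "P * A0 * transpose_mat P = four_block_mat S (0\<^sub>m r p) (0\<^sub>m p r) (0\<^sub>m p p)"
    unfolding assms(11) p_def[symmetric] using ST(1) by (simp add: Let_def)
  \<comment> \<open>Subtraction on naturals truncates; comparing row counts in the normal form shows
    that \<open>k - r\<close> is a true difference.\<close>
  have k: "k = r + p"
    using arg_cong[OF PA0, of dim_row] ST(1) assms(9) by simp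
  have GG: "G * transpose_mat G = dual_mat A0 A1"
    unfolding assms(7) using assms(5,6) by (rule dual_mat_of_base)
  \<comment> \<open>The symmetry of \<open>Z\<close>, which \<open>mu_attained\<close> requires, is
    inherited from the Gram matrix of \<open>G\<close>.\<close>
  have "transpose_mat (P * A1 * transpose_mat P) = P * A1 * transpose_mat P"
    using symmetric_of_dual_gram[OF assms(5,6) GG] assms(6,9)
    by (simp add: transpose_mult_dim mult_assoc_dim)
  then have sym: "four_block_mat (transpose_mat X) (transpose_mat (transpose_mat Y)) (transpose_mat Y) (transpose_mat Z)
      = four_block_mat X Y (transpose_mat Y) Z"
    unfolding assms(17)
    by (subst transpose_four_block_mat[OF assms(13) Y _ Z, symmetric]) (simp_all only: transpose_carrier_mat Y)
  have "transpose_mat X = X \<and> transpose_mat (transpose_mat Y) = Y \<and>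
      transpose_mat Y = transpose_mat Y \<and> transpose_mat Z = Z"
    by (rule four_block_mat_eq_iff[of _ r r _ p p, THEN iffD1, OF _ _ _ _ _ _ _ _ sym]; simp only: transpose_carrier_mat assms(13) Y Z)
  then have symZ: "transpose_mat Z = Z" by blast
  have "- Z \<in> carrier_mat p p" "transpose_mat (- Z) = - Z"
    using Z symZ by (simp_all add: transpose_uminus)
  from mu_attained[OF two this] obtain Q
    where Q: "Q \<in> carrier_mat p (2 * m)" "- Z = Q * K_mat m * transpose_mat Q"
    unfolding assms(18)[symmetric] .
  define l where "l = (if (-1) ^ (r + m) * det S \<in> nonzero_squares then r + 2 * m else r + 2 * m + 1)"
  \<comment> \<open>Embeddings of each length are now characterised by the normal form of the Gram
    matrix.\<close>
  have emb: "(\<exists>D. self_orthogonal_embedding n C N D) \<longleftrightarrow> (\<exists>l. N = n + l \<and>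
      gram_pair (r + p) l (four_block_mat S (0\<^sub>m r p) (0\<^sub>m p r) (0\<^sub>m p p)) (four_block_mat X Y (transpose_mat Y) Z))"
    for N
    unfolding self_orthogonal_embedding_iff[OF assms(3-6) GG]
      PA0[symmetric] assms(17)[symmetric] k[symmetric]
      gram_pair_congruence_iff[OF assms(9,10,5,6)] ..
  have "l = (if (-1) ^ (r + m) * (\<Prod>i<r. \<sigma> i) \<in> nonzero_squares then r + 2 * m else r + 2 * m + 1)"
    by (simp only: l_def detS(1))
  \<comment> \<open>The frame and an optimal \<open>Q\<close> yield an embedding of length
    \<open>n + l\<close>.\<close>
  from exists_hyperbolic_frame[OF two \<sigma> this] obtain E where "E \<in> carrier_mat (r + 2 * m) l"
    "E * transpose_mat E = four_block_mat (- S) (0\<^sub>m r (2 * m)) (0\<^sub>m (2 * m) r) (K_mat m)"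
    unfolding S by blast
  then have "gram_pair (r + p) l (four_block_mat S (0\<^sub>m r p) (0\<^sub>m p r) (0\<^sub>m p p))
      (four_block_mat X Y (transpose_mat Y) Z)"
    unfolding gram_pair_def
    by (intro exists_gram_pair[OF two ST _ Q(1) assms(13) Y ST1(1,4,3) _ Q(2) assms(14)])
  then have "\<exists>D. self_orthogonal_embedding n C (n + l) D" using emb by blast
  \<comment> \<open>No embedding is shorter: its added columns form a \<open>gram_pair\<close> for
    the normal form, and the lower bound applies.\<close>
  moreover have "n + l \<le> N" if "\<exists>D. self_orthogonal_embedding n C N D" for N
    using that gram_pair_lower_bound[OF ST assms(13) Y Z ST1(2) detS(2)] emb
    unfolding l_def assms(18) by auto
  ultimately have "n_s n C = n + l"
    unfolding n_s_def by (rule Least_equality)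
  then show ?thesis by (simp add: l_def)
qed

end
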